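(* For every field $K$ and every non-empty finite set $X$, the first-order theory of the free associative non-unitary algebra $\mathbb{A}^0_K(X)$, in the language of rings, is undecidable.
   Context: $\mathbb{A}^0_K(X)$ denotes the free associative algebra without unity over the field $K$ with basis $X$: the $K$-linear combinations of non-empty non-commutative monomials in $X$. It is regarded as a structure in the language of rings $\{+,\cdot,0\}$. *)

theory Defs
  imports "HOL-Library.Poly_Mapping" "HOL-Library.Nat_Bijection"
begin

section \<open>First-order logic in the language of rings without unity\<close>

datatype rterm = Var nat | Zero | Add rterm rterm | Mul rterm rterm

text \<open>The primitives \<open>\<not>\<close>, \<open>\<and>\<close>, \<open>\<exists>\<close> suffice for classical first-order logic with equality;
  the remaining connectives and the universal quantifier are the usual abbreviations.\<close>

datatype rformula =
    Eq rterm rterm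
  | Neg rformula
  | Conj rformula rformula
  | Exists nat rformula

primrec vars_term :: "rterm \<Rightarrow> nat set" where
  "vars_term (Var i) = {i}"
| "vars_term Zero = {}"
| "vars_term (Add s t) = vars_term s \<union> vars_term t"
| "vars_term (Mul s t) = vars_term s \<union> vars_term t"

primrec free_vars :: "rformula \<Rightarrow> nat set" where
  "free_vars (Eq s t) = vars_term s \<union> vars_term t"
| "free_vars (Neg \<phi>) = free_vars \<phi>"
| "free_vars (Conj \<phi> \<psi>) = free_vars \<phi> \<union> free_vars \<psi>"
| "free_vars (Exists i \<phi>) = free_vars \<phi> - {i}"

definition sentence :: "rformula \<Rightarrow> bool" where
  "sentence \<phi> \<longleftrightarrow> free_vars \<phi> = {}"

primrec eval_term :: "(nat \<Rightarrow> 'a::{plus,times,zero}) \<Rightarrow> rterm \<Rightarrow> 'a" where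
  "eval_term e (Var i) = e i"
| "eval_term e Zero = 0"
| "eval_term e (Add s t) = eval_term e s + eval_term e t"
| "eval_term e (Mul s t) = eval_term e s * eval_term e t"

text \<open>A structure is given by its carrier \<open>A\<close>, a set closed under the operations of the ambient
  type; quantifiers range over \<open>A\<close>.\<close>

primrec sat :: "'a::{plus,times,zero} set \<Rightarrow> (nat \<Rightarrow> 'a) \<Rightarrow> rformula \<Rightarrow> bool" where
  "sat A e (Eq s t) \<longleftrightarrow> eval_term e s = eval_term e t"
| "sat A e (Neg \<phi>) \<longleftrightarrow> \<not> sat A e \<phi>"
| "sat A e (Conj \<phi> \<psi>) \<longleftrightarrow> sat A e \<phi> \<and> sat A e \<psi>"
| "sat A e (Exists i \<phi>) \<longleftrightarrow> (\<exists>a\<in>A. sat A (e(i := a)) \<phi>)"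

definition elementary_theory :: "'a::{plus,times,zero} set \<Rightarrow> rformula set" where
  "elementary_theory A = {\<phi>. sentence \<phi> \<and> (\<forall>e. range e \<subseteq> A \<longrightarrow> sat A e \<phi>)}"

section \<open>Decidability\<close>

text \<open>\<open>recursive n f\<close>: the \<open>n\<close>-ary function \<open>f\<close> is (total) recursive. Arguments are passed as a list;
  only the values of \<open>f\<close> on lists of length \<open>n\<close> matter. Minimization is applied to regular
  functions only, so all functions generated are total.\<close>

inductive recursive :: "nat \<Rightarrow> (nat list \<Rightarrow> nat) \<Rightarrow> bool" where
  zero: "recursive n (\<lambda>_. 0)"
| succ: "recursive 1 (\<lambda>xs. Suc (xs ! 0))"
| proj: "i < n \<Longrightarrow> recursive n (\<lambda>xs. xs ! i)"
| comp: "recursive (length gs) f \<Longrightarrow> (\<forall>g\<in>set gs. recursive n g) \<Longrightarrow>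
    recursive n (\<lambda>xs. f (map (\<lambda>g. g xs) gs))"
| prim_rec: "recursive n f \<Longrightarrow> recursive (Suc (Suc n)) g \<Longrightarrow>
    recursive (Suc n) (\<lambda>xs. rec_nat (f (tl xs)) (\<lambda>y r. g (y # r # tl xs)) (hd xs))"
| minim: "recursive (Suc n) f \<Longrightarrow> (\<forall>xs. length xs = n \<longrightarrow> (\<exists>y. f (y # xs) = 0)) \<Longrightarrow>
    recursive n (\<lambda>xs. LEAST y. f (y # xs) = 0)"

definition decidable :: "nat set \<Rightarrow> bool" where
  "decidable S \<longleftrightarrow> (\<exists>f. recursive 1 f \<and> (\<forall>n. f [n] = (if n \<in> S then 1 else 0)))"

primrec code_term :: "rterm \<Rightarrow> nat" where
  "code_term (Var i) = prod_encode (0, i)"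
| "code_term Zero = prod_encode (1, 0)"
| "code_term (Add s t) = prod_encode (2, prod_encode (code_term s, code_term t))"
| "code_term (Mul s t) = prod_encode (3, prod_encode (code_term s, code_term t))"

primrec code :: "rformula \<Rightarrow> nat" where
  "code (Eq s t) = prod_encode (0, prod_encode (code_term s, code_term t))"
| "code (Neg \<phi>) = prod_encode (1, code \<phi>)"
| "code (Conj \<phi> \<psi>) = prod_encode (2, prod_encode (code \<phi>, code \<psi>))"
| "code (Exists i \<phi>) = prod_encode (3, prod_encode (i, code \<phi>))"

lemma code_term_inject: "code_term s = code_term t \<longleftrightarrow> s = t"
proof (induction s arbitrary: t)
  case (Var i) then show ?case by (cases t) auto
next
  case Zero then show ?case by (cases t) auto
next
  case (Add s1 s2) then show ?case by (cases t) auto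
next
  case (Mul s1 s2) then show ?case by (cases t) auto
qed

lemma code_inject: "code \<phi> = code \<psi> \<longleftrightarrow> \<phi> = \<psi>"
proof (induction \<phi> arbitrary: \<psi>)
  case (Eq s t) then show ?case by (cases \<psi>) (auto simp: code_term_inject)
next
  case (Neg \<phi>) then show ?case by (cases \<psi>) auto
next
  case (Conj \<phi>1 \<phi>2) then show ?case by (cases \<psi>) auto
next
  case (Exists i \<phi>) then show ?case by (cases \<psi>) auto
qed

definition decidable_theory :: "rformula set \<Rightarrow> bool" where
  "decidable_theory T \<longleftrightarrow> decidable (code ` T)"

section \<open>The free associative algebra without unity\<close>

text \<open>The free monoid of words, written additively so that \<open>'x word \<Rightarrow>\<^sub>0 'k\<close> carries the
  convolution product, i.e. is the free unital associative algebra over \<open>'k\<close> on all of \<open>'x\<close>.\<close>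

datatype 'x word = Word (letters: "'x list")

instantiation word :: (type) monoid_add
begin

definition zero_word :: "'a word" where
  "0 = Word []"

definition plus_word :: "'a word \<Rightarrow> 'a word \<Rightarrow> 'a word" where
  "u + v = Word (letters u @ letters v)"

instance
  by standard (simp_all add: zero_word_def plus_word_def)

end

definition free_assoc_algebra0 :: "'x set \<Rightarrow> ('x word \<Rightarrow>\<^sub>0 'k::field) set" where
  "free_assoc_algebra0 X =
    {p. \<forall>w\<in>Poly_Mapping.keys p. letters w \<noteq> [] \<and> set (letters w) \<subseteq> X}"

lemma zero_in_free_assoc_algebra0: "0 \<in> free_assoc_algebra0 X"
  by (simp add: free_assoc_algebra0_def)

lemma add_in_free_assoc_algebra0:
  assumes "p \<in> free_assoc_algebra0 X" "q \<in> free_assoc_algebra0 X"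
  shows "p + q \<in> free_assoc_algebra0 X"
  using assms Poly_Mapping.keys_add[of p q] unfolding free_assoc_algebra0_def by blast

lemma mult_in_free_assoc_algebra0:
  assumes "p \<in> free_assoc_algebra0 X" "q \<in> free_assoc_algebra0 X"
  shows "p * q \<in> free_assoc_algebra0 X"
proof -
  have "letters w \<noteq> [] \<and> set (letters w) \<subseteq> X" if w: "w \<in> Poly_Mapping.keys (p * q)" for w
  proof -
    obtain u v where "w = u + v" "u \<in> Poly_Mapping.keys p" "v \<in> Poly_Mapping.keys q"
      using w Poly_Mapping.keys_mult[of p q] by blast
    then show ?thesis
      using assms by (auto simp: free_assoc_algebra0_def plus_word_def)
  qed
  then show ?thesis by (simp add: free_assoc_algebra0_def)
qed

end

theory Submission
  imports Defs "HOL-Computational_Algebra.Polynomial"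
begin

text \<open>
  Call a nonzero element \<open>u\<close> polynomial-like if, in its centralizer \<open>C\<close>, every square is divisible
  by \<open>u\<close> and every element is \<open>c + u b\<close> with \<open>c = 0\<close> or \<open>c\<close> a divisor of \<open>u u\<close>. By degree
  considerations \<open>u\<close> then has minimal degree in \<open>C\<close>, the \<open>c\<close> are scalar multiples of \<open>u\<close>, and
  \<open>C = u K[u]\<close>; conversely the letters are polynomial-like. As \<open>u p(u) \<cdot> u q(u) = u \<cdot> u (p q)(u)\<close>,
  the ring \<open>K[x]\<close> with the constant \<open>x\<close> is interpretable in the algebra, with parameter any
  polynomial-like \<open>u\<close>.

  In \<open>K[x]\<close> the powers of \<open>x\<close> are definable and serve as natural numbers. Finite sequences of
  exponents are coded by Chinese remaindering modulo \<open>1 + w x^i\<close>, so all recursive functions are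
  definable. A decision procedure for the theory would therefore be expressible in the algebra, and
  diagonalization produces a sentence asserting that the procedure rejects it.
\<close>

section \<open>Definability in a polynomial ring with a constant for the indeterminate\<close>

abbreviation \<X> :: "'k::field poly" where "\<X> \<equiv> [:0, 1:]"

text \<open>Variables are de Bruijn indices: the quantifier binds index \<open>0\<close>.\<close>

inductive definable :: "((nat \<Rightarrow> 'k::field poly) \<Rightarrow> bool) \<Rightarrow> bool" where
  eq: "definable (\<lambda>e. e i = e j)"
| one: "definable (\<lambda>e. e i = 1)"
| indet: "definable (\<lambda>e. e i = \<X>)"
| add: "definable (\<lambda>e. e i + e j = e k)"
| mult: "definable (\<lambda>e. e i * e j = e k)"
| neg: "definable P \<Longrightarrow> definable (\<lambda>e. \<not> P e)"
| conj: "definable P \<Longrightarrow> definable Q \<Longrightarrow> definable (\<lambda>e. P e \<and> Q e)"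
| ex: "definable P \<Longrightarrow> definable (\<lambda>e. \<exists>p. P (case_nat p e))"

text \<open>Weakening and exchange of variables. Under a quantifier the renaming keeps index 0,
  which is bound there, and shifts all other indices.\<close>

lemma definable_rename: "definable P \<Longrightarrow> definable (\<lambda>e. P (\<lambda>i. e (h i)))"
proof (induction arbitrary: h rule: definable.induct)
  case (ex P)
  have *: "(\<lambda>i. case_nat p e (case_nat 0 (\<lambda>i. Suc (h i)) i)) = case_nat p (\<lambda>i. e (h i))" for p and e :: "nat \<Rightarrow> 'a poly"
    by (rule ext) (simp split: nat.split)
  show ?case
    using definable.ex[OF ex.IH[of "case_nat 0 (\<lambda>i. Suc (h i))"]] unfolding * .
qed (rule definable.intros; assumption?)+

text \<open>The abstracted \<open>Q\<close> lets \<open>intro\<close> descend through ordinary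
  quantifiers instead of environments of the form \<open>case_nat p e\<close>.\<close>

lemma definable_ex:
  assumes "definable (\<lambda>e. Q (e 0) (\<lambda>i. e (Suc i)))"
  shows "definable (\<lambda>e. \<exists>p. Q p e)"
  using definable.ex[OF assms] by simp

lemma definable_disj: "definable P \<Longrightarrow> definable Q \<Longrightarrow> definable (\<lambda>e. P e \<or> Q e)"
  using definable.neg[OF definable.conj[OF definable.neg[of P] definable.neg[of Q]]] by simp

lemma definable_imp: "definable P \<Longrightarrow> definable Q \<Longrightarrow> definable (\<lambda>e. P e \<longrightarrow> Q e)"
  unfolding imp_conv_disj by (intro definable_disj definable.neg)

lemma definable_all:
  assumes "definable (\<lambda>e. Q (e 0) (\<lambda>i. e (Suc i)))"
  shows "definable (\<lambda>e. \<forall>p. Q p e)"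
proof -
  have "definable (\<lambda>e. \<not> (\<exists>p. \<not> Q p e))"
    by (intro definable.neg definable_ex assms)
  then show ?thesis by simp
qed

section \<open>Functions with definable graph\<close>

definition definable_fun :: "((nat \<Rightarrow> 'k::field poly) \<Rightarrow> 'k poly) \<Rightarrow> bool" where
  "definable_fun f \<longleftrightarrow> definable (\<lambda>e. e 0 = f (\<lambda>i. e (Suc i)))"

lemma definable_fun_rename: "definable_fun f \<Longrightarrow> definable_fun (\<lambda>e. f (\<lambda>i. e (h i)))"
  unfolding definable_fun_def
  by (drule definable_rename[where h = "case_nat 0 (\<lambda>i. Suc (h i))"]) simp

text \<open>A function value is substituted by quantifying over it and asserting that it lies on the
  graph.\<close>

lemma definable_subst:
  assumes "definable_fun f" "definable (\<lambda>e. Q (e 0) (\<lambda>i. e (Suc i)))"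
  shows "definable (\<lambda>e. Q (f e) e)"
proof -
  have "definable (\<lambda>e. \<exists>p. p = f e \<and> Q p e)"
    by (rule definable_ex, rule definable.conj) (use assms in \<open>simp_all add: definable_fun_def\<close>)
  then show ?thesis by simp
qed

lemma definable_subst2:
  assumes "definable (\<lambda>e. R (e 0) (e 1))" "definable_fun f" "definable_fun g"
  shows "definable (\<lambda>e. R (f e) (g e))"
proof -
  have "definable (\<lambda>e. R (e 0) (g (\<lambda>i. e (Suc i))))"
  proof (rule definable_subst[where Q = "\<lambda>p e. R (e 0) p"])
    show "definable_fun (\<lambda>e. g (\<lambda>i. e (Suc i)))" by (rule definable_fun_rename[OF assms(3)])
    show "definable (\<lambda>e. R (e (Suc 0)) (e 0))"
      using definable_rename[OF assms(1), of "\<lambda>i. if i = 0 then 1 else 0"] by simp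
  qed
  from definable_subst[OF assms(2), where Q = "\<lambda>p e. R p (g e)", OF this] show ?thesis .
qed

lemma definable_fun_comp2:
  assumes "definable (\<lambda>e. e 0 = F (e 1) (e 2))" "definable_fun f" "definable_fun g"
  shows "definable_fun (\<lambda>e. F (f e) (g e))"
  unfolding definable_fun_def
proof (rule definable_subst[where f = "\<lambda>e. f (\<lambda>i. e (Suc i))" and Q = "\<lambda>p e. e 0 = F p (g (\<lambda>i. e (Suc i)))"])
  show "definable_fun (\<lambda>e. f (\<lambda>i. e (Suc i)))" by (rule definable_fun_rename[OF assms(2)])
  show "definable (\<lambda>e. e (Suc 0) = F (e 0) (g (\<lambda>i. e (Suc (Suc i)))))"
  proof (rule definable_subst[where f = "\<lambda>e. g (\<lambda>i. e (Suc (Suc i)))" and Q = "\<lambda>p e. e (Suc 0) = F (e 0) p"])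
    show "definable_fun (\<lambda>e. g (\<lambda>i. e (Suc (Suc i))))" by (rule definable_fun_rename[OF assms(3)])
    \<comment> \<open>The values of \<open>f\<close> and \<open>g\<close> are bound after the
      result, so the indices 0, 1, 2 appear reversed; i goes to 2 - i.\<close>
    show "definable (\<lambda>e. e (Suc (Suc 0)) = F (e (Suc 0)) (e 0))"
      using definable_rename[OF assms(1), of "\<lambda>i. 2 - i"] by (simp add: numeral_2_eq_2)
  qed
qed

lemma definable_fun_var: "definable_fun (\<lambda>e. e i)"
  unfolding definable_fun_def by (rule definable.eq)

lemma definable_fun_one: "definable_fun (\<lambda>e. 1)"
  unfolding definable_fun_def by (rule definable.one)

lemma definable_fun_X: "definable_fun (\<lambda>e. \<X>)"
  unfolding definable_fun_def by (rule definable.indet)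

lemma definable_fun_add: "definable_fun f \<Longrightarrow> definable_fun g \<Longrightarrow> definable_fun (\<lambda>e. f e + g e)"
proof (rule definable_fun_comp2[where F = "(+)"])
  show "definable (\<lambda>e. e 0 = e 1 + e 2)"
    using definable.add[of 1 2 0] by (simp add: eq_commute)
qed

lemma definable_fun_mult: "definable_fun f \<Longrightarrow> definable_fun g \<Longrightarrow> definable_fun (\<lambda>e. f e * g e)"
proof (rule definable_fun_comp2[where F = "(*)"])
  show "definable (\<lambda>e. e 0 = e 1 * e 2)"
    using definable.mult[of 1 2 0] by (simp add: eq_commute)
qed

lemma definable_fun_diff: "definable_fun f \<Longrightarrow> definable_fun g \<Longrightarrow> definable_fun (\<lambda>e. f e - g e)"
proof (rule definable_fun_comp2[where F = "(-)"])
  show "definable (\<lambda>e. e 0 = e 1 - e 2)"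
    using definable.add[of 0 2 1] by (simp add: eq_diff_eq)
qed

lemma definable_eq: "definable_fun f \<Longrightarrow> definable_fun g \<Longrightarrow> definable (\<lambda>e. f e = g e)"
  by (rule definable_subst2[where R = "(=)"]) (simp_all add: definable.eq)

lemma definable_dvd: "definable_fun f \<Longrightarrow> definable_fun g \<Longrightarrow> definable (\<lambda>e. f e dvd g e)"
proof (rule definable_subst2[where R = "(dvd)"])
  show "definable (\<lambda>e::nat \<Rightarrow> 'a poly. e 0 dvd e 1)"
    unfolding dvd_def by (intro definable_ex definable_eq definable_fun_mult definable_fun_var)
qed

lemmas definable_intros = definable.neg definable.conj definable_disj definable_imp definable_ex
  definable_all definable_eq definable_dvd definable_fun_var definable_fun_one definable_fun_X
  definable_fun_add definable_fun_mult definable_fun_diff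

section \<open>A divisibility criterion for powers of X in K[X]\<close>

lemma dvd_X_power: "d dvd \<X> ^ n \<Longrightarrow> d dvd 1 \<or> \<X> dvd (d :: 'k::field poly)"
proof (induction n)
  case (Suc n)
  then obtain q where q: "\<X> ^ Suc n = d * q" by (auto simp: dvd_def)
  \<comment> \<open>The power vanishes at 0, so X divides \<open>d\<close> or the cofactor
    \<open>q\<close>; in the second case one factor X cancels.\<close>
  have "poly d 0 = 0 \<or> poly q 0 = 0"
    using arg_cong[OF q, of "\<lambda>p. poly p 0"] by (simp del: power_Suc add: power_Suc)
  then show ?case
  proof
    assume "poly d 0 = 0"
    then show ?thesis by (simp add: poly_eq_0_iff_dvd)
  next
    assume "poly q 0 = 0"
    then obtain r where "q = \<X> * r" by (auto simp: poly_eq_0_iff_dvd dvd_def)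
    then have "\<X> * \<X> ^ n = \<X> * (d * r)" using q by (simp only: power_Suc mult.left_commute)
    then have "d dvd \<X> ^ n" by (simp only: mult_cancel_left) auto
    then show ?thesis by (rule Suc.IH)
  qed
qed simp

text \<open>If p is not a unit, the hypothesis applied to p itself splits off a factor X, and the
  degree drops.\<close>

lemma power_X_if_dvd:
  fixes p :: "'k::field poly"
  assumes "\<And>d. d dvd p \<Longrightarrow> d dvd 1 \<or> \<X> dvd d" "p \<noteq> 0"
  shows "\<exists>c n. p = [:c:] * \<X> ^ n"
  using assms
proof (induction "degree p" arbitrary: p rule: less_induct)
  case less
  show ?case
  proof (cases "p dvd 1")
    case True
    then obtain c where "p = [:c:]" by (auto simp: is_unit_poly_iff)
    then show ?thesis by (intro exI[of _ c] exI[of _ 0]) simp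
  next
    case False
    then obtain q where q: "p = \<X> * q" using less.prems(1)[of p] by (auto simp: dvd_def)
    have "\<exists>c n. q = [:c:] * \<X> ^ n"
    proof (rule less.hyps)
      show "q \<noteq> 0" using q less.prems(2) by auto
      then show "degree q < degree p" by (simp add: q)
      show "d dvd 1 \<or> \<X> dvd d" if "d dvd q" for d
        using less.prems(1)[of d] dvd_mult[OF that, of \<X>] q by simp
    qed
    then obtain c n where "q = [:c:] * \<X> ^ n" by blast
    then have "p = [:c:] * \<X> ^ Suc n" by (simp only: q power_Suc mult.left_commute)
    then show ?thesis by blast
  qed
qed

text \<open>The divisor condition leaves scalar multiples of powers of X. Divisibility of p - 1 by X
  - 1 says that p has value 1 at 1, which fixes the scalar. The criterion uses divisibility only, so
  it is definable.\<close>

lemma power_X_iff: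
  fixes p :: "'k::field poly"
  shows "(\<exists>n. p = \<X> ^ n) \<longleftrightarrow> (\<forall>d. d dvd p \<longrightarrow> d dvd 1 \<or> \<X> dvd d) \<and> (\<X> - 1) dvd (p - 1)"
proof -
  have X1: "(\<X> - 1 :: 'k poly) = [:- 1, 1:]" by (simp add: one_pCons)
  have dvd: "(\<X> - 1) dvd (p - 1) \<longleftrightarrow> poly p 1 = 1"
    unfolding X1 using poly_eq_0_iff_dvd[of "p - 1" 1] by auto
  show ?thesis unfolding dvd
  proof safe
    fix n d assume "d dvd (\<X> ^ n :: 'k poly)" "\<not> \<X> dvd d"
    then show "d dvd 1" using dvd_X_power by blast
  next
    fix n show "poly (\<X> ^ n :: 'k poly) 1 = 1" by simp
  next
    assume *: "\<forall>d. d dvd p \<longrightarrow> d dvd 1 \<or> \<X> dvd d" "poly p 1 = 1"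
    then have "p \<noteq> 0" by auto
    then obtain c n where cn: "p = [:c:] * \<X> ^ n" using power_X_if_dvd[of p] * by blast
    then have "c = 1" using *(2) by simp
    then show "\<exists>n. p = \<X> ^ n" using cn by auto
  qed
qed

lemma X_power_inject: "\<X> ^ m = (\<X> ^ n :: 'k::field poly) \<longleftrightarrow> m = n"
proof
  assume "\<X> ^ m = (\<X> ^ n :: 'k poly)"
  from arg_cong[OF this, of degree] show "m = n" by (simp add: degree_power_eq)
qed simp

section \<open>Natural numbers as powers of X\<close>

definition exponent :: "'k::field poly \<Rightarrow> nat" where
  "exponent p = (if \<exists>n. p = \<X> ^ n then THE n. p = \<X> ^ n else 0)"

lemma exponent_X_power [simp]: "exponent (\<X> ^ n) = n"
  by (auto simp: exponent_def X_power_inject)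

text \<open>The natural number \<open>n\<close> is represented by \<open>\<X> ^ n\<close>; \<^const>\<open>exponent\<close> decodes every other
  polynomial to \<open>0\<close>.\<close>

definition definable_nat :: "((nat \<Rightarrow> 'k::field poly) \<Rightarrow> nat) \<Rightarrow> bool" where
  "definable_nat g \<longleftrightarrow> definable_fun (\<lambda>e. \<X> ^ g e)"

lemma definable_power_X: "definable_fun f \<Longrightarrow> definable (\<lambda>e. \<exists>n. f e = \<X> ^ n)"
proof (rule definable_subst[where Q = "\<lambda>p e. \<exists>n. p = \<X> ^ n"])
  show "definable (\<lambda>e::nat \<Rightarrow> 'a poly. \<exists>n. e 0 = \<X> ^ n)"
    unfolding power_X_iff by (intro definable_intros)
qed

lemma definable_nat_exponent: "definable_nat (\<lambda>e. exponent (e i))"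
proof -
  \<comment> \<open>The second case is the default exponent 0, that is, the power 1.\<close>
  have *: "(p = \<X> ^ exponent q) \<longleftrightarrow> (\<exists>n. q = \<X> ^ n) \<and> p = q \<or> \<not> (\<exists>n. q = \<X> ^ n) \<and> p = 1" for p q :: "'a poly"
    by (cases "\<exists>n. q = \<X> ^ n") (auto simp: exponent_def X_power_inject)
  show ?thesis
    unfolding definable_nat_def definable_fun_def *
    by (intro definable_power_X definable_intros)
qed

lemma definable_nat_rename: "definable_nat g \<Longrightarrow> definable_nat (\<lambda>e. g (\<lambda>i. e (h i)))"
  unfolding definable_nat_def by (rule definable_fun_rename)

lemma definable_nat_const: "definable_nat (\<lambda>e. n)"
  unfolding definable_nat_def
  by (induction n) (simp_all only: power_0 power_Suc definable_intros)

lemma definable_nat_add: "definable_nat f \<Longrightarrow> definable_nat g \<Longrightarrow> definable_nat (\<lambda>e. f e + g e)"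
  unfolding definable_nat_def by (simp only: power_add definable_intros)

lemma definable_nat_Suc: "definable_nat f \<Longrightarrow> definable_nat (\<lambda>e. Suc (f e))"
  unfolding definable_nat_def by (simp only: power_Suc definable_intros)

lemma definable_nat_eq: "definable_nat f \<Longrightarrow> definable_nat g \<Longrightarrow> definable (\<lambda>e. f e = g e)"
  unfolding definable_nat_def using definable_eq[of "\<lambda>e. \<X> ^ f e" "\<lambda>e. \<X> ^ g e"] by (simp only: X_power_inject)

text \<open>As \<open>exponent\<close> is onto, one quantifies over all polynomials and decodes,
  without relativizing to powers of X.\<close>

lemma definable_ex_nat:
  fixes Q :: "nat \<Rightarrow> (nat \<Rightarrow> 'k::field poly) \<Rightarrow> bool"
  assumes "definable (\<lambda>e. Q (exponent (e 0)) (\<lambda>i. e (Suc i)))"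
  shows "definable (\<lambda>e. \<exists>n. Q n e)"
proof -
  have *: "(\<exists>n. Q n e) \<longleftrightarrow> (\<exists>p::'k poly. Q (exponent p) e)" for e
    by (metis exponent_X_power)
  show ?thesis unfolding * by (rule definable_ex) (rule assms)
qed

lemma definable_all_nat:
  assumes "definable (\<lambda>e. Q (exponent (e 0)) (\<lambda>i. e (Suc i)))"
  shows "definable (\<lambda>e. \<forall>n. Q n e)"
proof -
  have "definable (\<lambda>e. \<not> (\<exists>n. \<not> Q n e))"
    by (intro definable.neg definable_ex_nat) (rule assms)
  then show ?thesis by simp
qed

lemma definable_nat_less:
  assumes "definable_nat f" "definable_nat g"
  shows "definable (\<lambda>e. f e < g e)"
proof -
  have "definable (\<lambda>e::nat \<Rightarrow> 'a poly. exponent (e 0) < exponent (e 1))"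
    unfolding less_iff_Suc_add
    by (intro definable_ex_nat definable_nat_eq definable_nat_Suc definable_nat_add definable_nat_exponent)
  from definable_subst2[where R = "\<lambda>p q. exponent p < exponent q", OF this,
      of "\<lambda>e. \<X> ^ f e" "\<lambda>e. \<X> ^ g e"]
  show ?thesis using assms by (simp add: definable_nat_def)
qed

text \<open>Reduces the graph of \<open>\<X> ^ f e\<close> to a relation between numbers. Non-powers
  also decode to a number, so the graph is the power condition together with the equation of
  exponents.\<close>

lemma definable_natI:
  assumes "definable (\<lambda>e. exponent (e 0) = f (\<lambda>i. e (Suc i)))"
  shows "definable_nat f"
proof -
  have *: "p = \<X> ^ n \<longleftrightarrow> (\<exists>n. p = \<X> ^ n) \<and> exponent p = n" for p :: "'a poly" and n
    by auto
  show ?thesis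
    unfolding definable_nat_def definable_fun_def
    by (subst *) (intro definable.conj definable_power_X definable_fun_var assms)
qed

lemma definable_nat_Least:
  assumes P: "definable (\<lambda>e. P (exponent (e 0)) (\<lambda>i. e (Suc i)))" and ex: "\<And>e. \<exists>y. P y e"
  shows "definable_nat (\<lambda>e. LEAST y. P y e)"
proof (rule definable_natI)
  have *: "n = (LEAST y. P y e) \<longleftrightarrow> P n e \<and> (\<forall>m. m < n \<longrightarrow> \<not> P m e)" for n e
    using ex[of e] by (metis LeastI_ex Least_equality not_less not_less_Least)
  show "definable (\<lambda>e. exponent (e 0) = (LEAST y. P y (\<lambda>i. e (Suc i))))"
    unfolding *
  proof (intro definable.conj definable_all_nat definable_imp definable.neg definable_nat_less definable_nat_exponent P)
    show "definable (\<lambda>e. P (exponent (e 0)) (\<lambda>i. e (Suc (Suc i))))"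
      using definable_rename[OF P, of "case_nat 0 (\<lambda>i. Suc (Suc i))"] by simp
  qed
qed

section \<open>Coding of finite sequences and recursive functions\<close>

definition comaximal :: "'a::comm_ring_1 \<Rightarrow> 'a \<Rightarrow> bool" where
  "comaximal p q \<longleftrightarrow> (\<exists>a b. a * p + b * q = 1)"

lemma comaximal_mult:
  assumes "comaximal p q" "comaximal p r"
  shows "comaximal p (q * r)"
proof -
  obtain a b c d where ab: "a * p + b * q = 1" and cd: "c * p + d * r = 1"
    using assms unfolding comaximal_def by blast
  \<comment> \<open>Multiply the two Bezout identities: every term except the one with
    \<open>q * r\<close> is a multiple of \<open>p\<close>.\<close>
  have "(a * c * p + a * d * r + b * q * c) * p + (b * d) * (q * r) = (a * p + b * q) * (c * p + d * r)"
    by (simp add: algebra_simps)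
  then show ?thesis unfolding ab cd comaximal_def by auto
qed

lemma comaximal_prod:
  assumes "\<And>i. i \<in> I \<Longrightarrow> comaximal p (m i)"
  shows "comaximal p (prod m I)"
  using assms
proof (induction I rule: infinite_finite_induct)
  case (insert i I) then show ?case by (simp add: comaximal_mult)
qed (auto simp: comaximal_def intro: exI[of _ 0] exI[of _ 1])

lemma comaximal_dvd:
  assumes "comaximal p q" "r dvd q"
  shows "comaximal p r"
proof -
  obtain a b s where "a * p + b * q = 1" "q = r * s"
    using assms unfolding comaximal_def dvd_def by blast
  then have "a * p + (b * s) * r = 1" by (simp add: algebra_simps)
  then show ?thesis unfolding comaximal_def by blast
qed

lemma comaximal_diff:
  assumes "comaximal p (p - q)"
  shows "comaximal p q"
proof -
  obtain a b where "a * p + b * (p - q) = 1"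
    using assms unfolding comaximal_def by blast
  then have "(a + b) * p + (- b) * q = 1" by (simp add: algebra_simps)
  then show ?thesis unfolding comaximal_def by blast
qed

lemma comaximal_commute: "comaximal p q \<longleftrightarrow> comaximal q p"
  unfolding comaximal_def by (metis add.commute)

lemma comaximal_chinese_remainder:
  fixes m a :: "nat \<Rightarrow> 'a::comm_ring_1"
  assumes "\<And>i j. i < j \<Longrightarrow> j < n \<Longrightarrow> comaximal (m i) (m j)"
  shows "\<exists>c. \<forall>i<n. m i dvd c - a i"
  using assms
proof (induction n)
  case (Suc n)
  then obtain c where c: "\<forall>i<n. m i dvd c - a i" by (metis less_Suc_eq)
  have "comaximal (m n) (prod m {..<n})"
    using Suc.prems by (intro comaximal_prod) (simp add: comaximal_commute)
  then obtain s t where st: "s * m n + t * prod m {..<n} = 1" unfolding comaximal_def by blast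
  \<comment> \<open>The correction is 0 modulo the earlier moduli and \<open>a n - c\<close> modulo
    \<open>m n\<close>.\<close>
  define c' where "c' = c + (a n - c) * (t * prod m {..<n})"
  have "m i dvd c' - a i" if "i < Suc n" for i
  proof (cases "i = n")
    case True
    have "c' - a n = (c - a n) * (1 - t * prod m {..<n})" by (simp add: c'_def algebra_simps)
    also have "1 - t * prod m {..<n} = s * m n" using st by (simp add: algebra_simps)
    finally show ?thesis using True by simp
  next
    case False
    then have "i < n" using that by simp
    then have "m i dvd prod m {..<n}" by (intro dvd_prodI) auto
    then have "m i dvd (c - a i) + (a n - c) * (t * prod m {..<n})"
      using c \<open>i < n\<close> by (intro dvd_add dvd_mult) auto
    then show ?thesis by (simp add: c'_def algebra_simps)
  qed
  then show ?case by blast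
qed simp

text \<open>A polynomial analogue of Goedel's beta function: the pair \<open>w\<close>,
  \<open>c\<close> codes a sequence with i-th entry \<open>a\<close>. Several powers of X may be
  congruent modulo \<open>1 + w * \<X> ^ i\<close>; taking the least exponent makes the entry
  unique.\<close>

definition seq_val :: "'k::field poly \<Rightarrow> 'k poly \<Rightarrow> nat \<Rightarrow> nat \<Rightarrow> bool" where
  "seq_val w c i a \<longleftrightarrow> (1 + w * \<X> ^ i) dvd (c - \<X> ^ a) \<and> (\<forall>b. b < a \<longrightarrow> \<not> (1 + w * \<X> ^ i) dvd (c - \<X> ^ b))"

lemma seq_val_unique: "seq_val w c i a \<Longrightarrow> seq_val w c i b \<Longrightarrow> a = b"
  unfolding seq_val_def by (metis linorder_neqE_nat)

text \<open>The factors \<open>1 - \<X> ^ j\<close> of \<open>w\<close> make the moduli pairwise comaximal, and the factor \<open>\<X> ^ M\<close>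
  makes their degrees exceed all values, so that the values are the least solutions.\<close>

lemma seq_val_exists:
  fixes r :: "nat \<Rightarrow> nat"
  shows "\<exists>w c :: 'k::field poly. \<forall>i\<le>k. seq_val w c i (r i)"
proof -
  define M where "M = Suc (Max (r ` {..k}))"
  have M: "r i < M" if "i \<le> k" for i
    using that unfolding M_def by (simp add: less_Suc_eq_le)
  define w :: "'k poly" where "w = \<X> ^ M * (\<Prod>j\<in>{1..k}. (1 - \<X> ^ j))"
  define m where "m i = 1 + w * \<X> ^ i" for i
  have nz: "1 - \<X> ^ j \<noteq> (0 :: 'k poly)" if "j > 0" for j
    using that X_power_inject[of 0 j, where ?'k = 'k] by auto
  have w0: "w \<noteq> 0"
    unfolding w_def using nz by auto
  have "degree w = M + degree (\<Prod>j\<in>{1..k}. (1 - \<X> ^ j :: 'k poly))"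
    unfolding w_def using nz by (subst degree_mult_eq) (auto simp: degree_power_eq)
  then have degw: "degree w \<ge> M" by simp
  have degm: "degree (m i) \<ge> M" for i
  proof -
    have *: "degree (w * \<X> ^ i) = degree w + i"
      using w0 by (simp add: degree_mult_eq degree_power_eq)
    have "degree w > 0" using degw by (simp add: M_def)
    then have "degree (m i) = degree (w * \<X> ^ i)"
      unfolding m_def by (intro degree_add_eq_right) (simp add: *)
    then show ?thesis using * degw by simp
  qed
  have com_w: "comaximal (m i) w" for i
    unfolding comaximal_def by (rule exI[of _ 1], rule exI[of _ "- (\<X> ^ i)"]) (simp add: m_def mult.commute)
  have com_X: "comaximal (m i) \<X>" for i
    by (rule comaximal_dvd[OF com_w]) (simp only: w_def M_def power_Suc mult.assoc dvd_triv_left)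
  have com_X': "comaximal (m i) (\<X> ^ n)" for i n
  proof (induction n)
    case 0
    have "0 * m i + 1 * 1 = 1" by simp
    then show ?case unfolding power_0 comaximal_def by blast
  next
    case (Suc n)
    then show ?case unfolding power_Suc by (rule comaximal_mult[OF com_X])
  qed
  have com: "comaximal (m i) (m j)" if "i < j" "j \<le> k" for i j
  proof (rule comaximal_diff)
    have "comaximal (m i) (1 - \<X> ^ (j - i))"
    proof (rule comaximal_dvd[OF com_w])
      show "(1 - \<X> ^ (j - i)) dvd w"
        unfolding w_def by (intro dvd_mult dvd_prodI) (use that in auto)
    qed
    \<comment> \<open>This product is the difference of the two moduli, so \<open>m i\<close> is
      comaximal with \<open>m j\<close> as well.\<close>
    then have "comaximal (m i) (w * (\<X> ^ i * (1 - \<X> ^ (j - i))))"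
      by (intro comaximal_mult com_w com_X')
    also have "w * (\<X> ^ i * (1 - \<X> ^ (j - i))) = m i - m j"
      using that by (simp add: m_def right_diff_distrib power_add[symmetric])
    finally show "comaximal (m i) (m i - m j)" .
  qed
  obtain c where c: "\<forall>i<Suc k. m i dvd c - \<X> ^ r i"
    using comaximal_chinese_remainder[of "Suc k" m "\<lambda>i. \<X> ^ r i"] com by (auto simp: less_Suc_eq_le)
  have "seq_val w c i (r i)" if "i \<le> k" for i
    unfolding seq_val_def m_def[symmetric]
  proof (intro conjI allI impI notI)
    show "m i dvd c - \<X> ^ r i" using c that by simp
    \<comment> \<open>A smaller exponent would make \<open>m i\<close> divide a nonzero polynomial
      of degree at most \<open>r i\<close>, while \<open>m i\<close> has degree at least M, which
      exceeds \<open>r i\<close>.\<close>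
    fix b assume b: "b < r i" "m i dvd c - \<X> ^ b"
    have "m i dvd c - \<X> ^ r i" using c that by simp
    with b(2) have "m i dvd (c - \<X> ^ b) - (c - \<X> ^ r i)" by (rule dvd_diff)
    then have dvd: "m i dvd (\<X> ^ r i - \<X> ^ b)" by simp
    have "\<X> ^ r i - \<X> ^ b \<noteq> (0 :: 'k poly)" using b X_power_inject[of "r i" b, where ?'k = 'k] by auto
    with dvd have "degree (m i) \<le> degree (\<X> ^ r i - \<X> ^ b :: 'k poly)" by (rule dvd_imp_degree_le)
    also have "\<dots> \<le> r i"
      using b by (intro degree_diff_le) (auto simp: degree_power_eq)
    finally show False using degm[of i] M[OF that] by simp
  qed
  then show ?thesis by blast
qed

lemma definable_fun_X_power: "definable_nat g \<Longrightarrow> definable_fun (\<lambda>e. \<X> ^ g e)"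
  by (simp add: definable_nat_def)

lemma definable_seq_val:
  assumes "definable_fun w" "definable_fun c" "definable_nat i" "definable_nat a"
  shows "definable (\<lambda>e. seq_val (w e) (c e) (i e) (a e))"
proof -
  note shift = assms(1-2)[THEN definable_fun_rename[where h = Suc]]
    assms(3-4)[THEN definable_nat_rename[where h = Suc]]
  show ?thesis
    unfolding seq_val_def
    by (intro definable.conj definable_all_nat definable_imp definable.neg definable_dvd
        definable_nat_less definable_fun_diff definable_fun_add definable_fun_mult definable_fun_one
        definable_fun_X_power definable_nat_exponent shift assms)
qed

text \<open>Primitive recursion by its history: the coded sequence starts with b, obeys the
  recursion below k and has v at position k. A code exists for the true history, and uniqueness of
  entries forces any coded history to agree with it up to k.\<close>

lemma rec_nat_iff_seq_val:
  "v = rec_nat b s k \<longleftrightarrow> (\<exists>w c :: 'k::field poly. seq_val w c 0 b \<and> seq_val w c k v \<and>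
    (\<forall>i. i < k \<longrightarrow> (\<exists>a. seq_val w c i a \<and> seq_val w c (Suc i) (s i a))))"
proof
  assume v: "v = rec_nat b s k"
  obtain w c :: "'k poly" where wc: "\<forall>i\<le>k. seq_val w c i (rec_nat b s i)"
    using seq_val_exists by blast
  show "\<exists>w c :: 'k::field poly. seq_val w c 0 b \<and> seq_val w c k v \<and>
    (\<forall>i. i < k \<longrightarrow> (\<exists>a. seq_val w c i a \<and> seq_val w c (Suc i) (s i a)))"
  proof (intro exI conjI allI impI)
    show "seq_val w c 0 b" using wc[rule_format, of 0] by simp
    show "seq_val w c k v" using wc v by simp
    fix i assume "i < k"
    then show "seq_val w c i (rec_nat b s i)" "seq_val w c (Suc i) (s i (rec_nat b s i))"
      using wc[rule_format, of i] wc[rule_format, of "Suc i"] by auto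
  qed
next
  assume "\<exists>w c :: 'k::field poly. seq_val w c 0 b \<and> seq_val w c k v \<and>
    (\<forall>i. i < k \<longrightarrow> (\<exists>a. seq_val w c i a \<and> seq_val w c (Suc i) (s i a)))"
  then obtain w c :: "'k poly" where wc: "seq_val w c 0 b" "seq_val w c k v"
    "\<And>i. i < k \<Longrightarrow> \<exists>a. seq_val w c i a \<and> seq_val w c (Suc i) (s i a)" by blast
  have "i \<le> k \<Longrightarrow> seq_val w c i (rec_nat b s i)" for i
  proof (induction i)
    case (Suc i)
    then obtain a where a: "seq_val w c i a" "seq_val w c (Suc i) (s i a)" using wc(3)[of i] by auto
    then have "a = rec_nat b s i" using Suc seq_val_unique by auto
    then show ?case using a by simp
  qed (use wc in simp)
  then show "v = rec_nat b s k" using wc(2) seq_val_unique by blast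
qed

lemma definable_nat_rec:
  fixes s :: "nat \<Rightarrow> nat \<Rightarrow> (nat \<Rightarrow> 'k::field poly) \<Rightarrow> nat"
  assumes b: "definable_nat b" and k: "definable_nat k"
    and s: "definable_nat (\<lambda>e. s (exponent (e 0)) (exponent (e 1)) (\<lambda>i. e (Suc (Suc i))))"
  shows "definable_nat (\<lambda>e. rec_nat (b e) (\<lambda>y r. s y r e) (k e))"
proof -
  \<comment> \<open>Inside all binders the indices 0 to 4 hold the current entry, the step i,
    \<open>c\<close>, \<open>w\<close> and the result; the parameters start at 5.\<close>
  have s': "definable_nat (\<lambda>e. s (exponent (e (Suc 0))) (exponent (e 0)) (\<lambda>i. e (Suc (Suc (Suc (Suc (Suc i)))))))"
    using definable_nat_rename[OF s, of "\<lambda>i. case i of 0 \<Rightarrow> 1 | Suc i \<Rightarrow> (case i of 0 \<Rightarrow> 0 | Suc j \<Rightarrow> Suc (Suc (Suc (Suc (Suc j)))))"]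
    by simp
  note b' = definable_nat_rename[OF b, of "\<lambda>i. Suc (Suc (Suc i))"]
  note k' = definable_nat_rename[OF k, of "\<lambda>i. Suc (Suc (Suc i))"]
  note k'' = definable_nat_rename[OF k, of "\<lambda>i. Suc (Suc (Suc (Suc i)))"]
  show ?thesis
    by (rule definable_natI, subst rec_nat_iff_seq_val[where ?'k = 'k])
      (intro definable_ex definable.conj definable_all_nat definable_imp definable_ex_nat
        definable_seq_val definable_fun_var definable_nat_const definable_nat_exponent
        definable_nat_less definable_nat_Suc b' k' k'' s')
qed

text \<open>The argument functions \<open>gs\<close> stay arbitrary, so composition is substitution.
  Primitive recursion uses coded histories, and regularity supplies the zero that minimization
  requires.\<close>

lemma definable_nat_recursive:
  fixes gs :: "((nat \<Rightarrow> 'k::field poly) \<Rightarrow> nat) list"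
  assumes "recursive n f" "length gs = n" "\<And>g. g \<in> set gs \<Longrightarrow> definable_nat g"
  shows "definable_nat (\<lambda>e. f (map (\<lambda>g. g e) gs))"
  using assms
proof (induction arbitrary: gs rule: recursive.induct)
  case (zero n)
  show ?case by (rule definable_nat_const)
next
  case succ
  then show ?case by (auto simp: length_Suc_conv intro: definable_nat_Suc)
next
  case (proj i n)
  then show ?case by simp
next
  case (comp hs f n)
  have "definable_nat (\<lambda>e. f (map (\<lambda>g. g e) (map (\<lambda>h e. h (map (\<lambda>g. g e) gs)) hs)))"
    by (rule comp.IH(1)) (use comp in auto)
  then show ?case by (simp add: comp_def)
next
  case (prim_rec n f g)
  then obtain g0 gs' where gs: "gs = g0 # gs'" "length gs' = n" by (auto simp: length_Suc_conv)
  have "definable_nat (\<lambda>e. rec_nat (f (map (\<lambda>g. g e) gs')) (\<lambda>y r. g (y # r # map (\<lambda>g. g e) gs')) (g0 e))"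
  proof (rule definable_nat_rec)
    show "definable_nat (\<lambda>e. f (map (\<lambda>g. g e) gs'))"
      using prim_rec gs by auto
    show "definable_nat g0" using prim_rec gs by auto
    have "definable_nat (\<lambda>e. g (map (\<lambda>g. g e) ((\<lambda>e. exponent (e 0)) # (\<lambda>e. exponent (e 1)) #
        map (\<lambda>g e. g (\<lambda>i. e (Suc (Suc i)))) gs')))"
      by (rule prim_rec.IH(2)) (use gs prim_rec.prems in \<open>auto intro: definable_nat_exponent definable_nat_rename\<close>)
    then show "definable_nat (\<lambda>e. g (exponent (e 0) # exponent (e 1) # map (\<lambda>g. g (\<lambda>i. e (Suc (Suc i)))) gs'))"
      by (simp add: comp_def)
  qed
  then show ?case by (simp add: gs)
next
  case (minim n f)
  show ?case
  proof (rule definable_nat_Least)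
    have "definable_nat (\<lambda>e. f (map (\<lambda>g. g e) ((\<lambda>e. exponent (e 0)) # map (\<lambda>g e. g (\<lambda>i. e (Suc i))) gs)))"
      by (rule minim.IH) (use minim.prems in \<open>auto intro: definable_nat_exponent definable_nat_rename\<close>)
    then show "definable (\<lambda>e. f (exponent (e 0) # map (\<lambda>g. g (\<lambda>i. e (Suc i))) gs) = 0)"
      by (intro definable_nat_eq definable_nat_const) (simp add: comp_def)
    show "\<exists>y. f (y # map (\<lambda>g. g e) gs) = 0" for e
      using minim by simp
  qed
qed

lemma definable_nat_prod_encode:
  assumes "definable_nat f" "definable_nat g"
  shows "definable_nat (\<lambda>e. prod_encode (f e, g e))"
proof -
  \<comment> \<open>Triangular numbers by recursion on sums, so that no product of exponents
    occurs.\<close>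
  have triangle: "triangle n = rec_nat 0 (\<lambda>y r. r + Suc y) n" for n
    by (induction n) simp_all
  show ?thesis
    unfolding prod_encode_def triangle prod.case
    by (intro definable_nat_add definable_nat_rec definable_nat_const definable_nat_Suc definable_nat_exponent assms)
qed

section \<open>Undecidability of structures interpreting a polynomial ring\<close>

text \<open>With \<open>u\<close> for variable \<open>0\<close>, the value is \<open>u\<close> to the power \<open>n + 1\<close>, which represents \<open>\<X> ^ n\<close>.\<close>

primrec numeral_term :: "nat \<Rightarrow> rterm" where
  "numeral_term 0 = Var 0"
| "numeral_term (Suc n) = Mul (Var 0) (numeral_term n)"

text \<open>Needed for self-reference: the diagonal sentence contains the numeral of a code, and its
  own code must be a definable function of that number.\<close>

lemma definable_nat_code_numeral_term:
  assumes "definable_nat f"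
  shows "definable_nat (\<lambda>e. code_term (numeral_term (f e)))"
proof -
  have "code_term (numeral_term n) =
    rec_nat (code_term (Var 0)) (\<lambda>y r. prod_encode (3, prod_encode (code_term (Var 0), r))) n" for n
    by (induction n) simp_all
  then show ?thesis
    by (simp only:) (intro definable_nat_rec definable_nat_prod_encode definable_nat_const
        definable_nat_exponent assms)
qed

lemma vars_numeral_term: "vars_term (numeral_term n) = {0}"
  by (induction n) auto

text \<open>The intended \<open>rep u p\<close> is u p(u). The shift by \<open>u\<close> compensates
  for the missing unity: \<open>u\<close> plays the role of 1, and products carry an extra factor
  \<open>u\<close>. The formula \<open>\<gamma>\<close> singles out the admissible parameters, each
  of which gives an interpretation of K[X].\<close>

locale polynomial_interpretation =
  fixes A :: "'a::{plus,times,zero} set" and U :: "'a set" and \<gamma> :: rformula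
    and rep :: "'a \<Rightarrow> 'k::field poly \<Rightarrow> 'a"
  assumes U: "U \<subseteq> A" "U \<noteq> {}"
    and zero: "0 \<in> A"
    and free_vars_\<gamma>: "free_vars \<gamma> \<subseteq> {0}"
    and sat_\<gamma>: "\<And>E. E 0 \<in> A \<Longrightarrow> sat A E \<gamma> \<longleftrightarrow> E 0 \<in> U"
    and bij_rep: "\<And>u. u \<in> U \<Longrightarrow> bij_betw (rep u) UNIV {a \<in> A. a * u = u * a}"
    and rep_add: "\<And>u p q. u \<in> U \<Longrightarrow> rep u (p + q) = rep u p + rep u q"
    and rep_mult: "\<And>u p q. u \<in> U \<Longrightarrow> rep u p * rep u q = u * rep u (p * q)"
    and rep_one: "\<And>u. u \<in> U \<Longrightarrow> rep u 1 = u"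
    and rep_X: "\<And>u p. u \<in> U \<Longrightarrow> rep u (pCons 0 p) = u * rep u p"
begin

lemma rep_eq_iff: "u \<in> U \<Longrightarrow> rep u p = rep u q \<longleftrightarrow> p = q"
  using bij_rep[of u] by (auto simp: bij_betw_def dest: injD)

text \<open>The factor \<open>u\<close> acts on representatives as multiplication by X, so both
  sides represent polynomials with a common factor X, and \<open>rep\<close> is injective.\<close>

lemma rep_eq_iff_mult: "u \<in> U \<Longrightarrow> rep u p * rep u q = u * rep u r \<longleftrightarrow> p * q = r"
  by (simp add: rep_mult rep_X[symmetric] rep_eq_iff)

lemma ex_rep_iff:
  assumes "u \<in> U"
  shows "(\<exists>a\<in>A. a * u = u * a \<and> P a) \<longleftrightarrow> (\<exists>p. P (rep u p))"
proof -
  have "range (rep u) = {a \<in> A. a * u = u * a}" using bij_rep[OF assms] by (simp add: bij_betw_def)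
  then show ?thesis by (metis (mono_tags, lifting) mem_Collect_eq rangeE rangeI)
qed

lemma rep_X_power: "u \<in> U \<Longrightarrow> E 0 = u \<Longrightarrow> eval_term E (numeral_term n) = rep u (\<X> ^ n)"
  by (induction n) (simp_all add: rep_one rep_X)

text \<open>Variable \<open>0\<close> holds the parameter \<open>u\<close>, variable \<open>h i\<close> the representative of the \<open>i\<close>-th
  polynomial. Keeping \<open>h\<close> arbitrary lets the quantifier case pick a fresh variable, and a constant
  \<open>h\<close> turns a unary relation into a formula in variables \<open>0\<close> and \<open>1\<close>.\<close>

definition expresses :: "rformula \<Rightarrow> nat \<Rightarrow> (nat \<Rightarrow> nat) \<Rightarrow> ((nat \<Rightarrow> 'k poly) \<Rightarrow> bool) \<Rightarrow> bool" where
  "expresses \<phi> N h P \<longleftrightarrow> free_vars \<phi> \<subseteq> {0} \<union> h ` {..<N} \<and>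
    (\<forall>E e. E 0 \<in> U \<longrightarrow> (\<forall>i<N. E (h i) = rep (E 0) (e i)) \<longrightarrow> (sat A E \<phi> \<longleftrightarrow> P e))"

text \<open>Translation of relations on K[X] into formulas of the algebra. The bound
  \<open>N\<close> precedes \<open>h\<close> because the quantifier case applies the induction
  hypothesis to a modified \<open>h\<close>.\<close>

lemma definable_imp_expresses:
  assumes "definable P"
  shows "\<exists>N. \<forall>h. (\<forall>i. h i \<noteq> 0) \<longrightarrow> (\<exists>\<phi>. expresses \<phi> N h P)"
  using assms
proof (induction rule: definable.induct)
  case (eq i j)
  have "expresses (Eq (Var (h i)) (Var (h j))) (Suc (max i j)) h (\<lambda>e. e i = e j)" for h
    by (auto simp: expresses_def rep_eq_iff)
  then show ?case by blast
next
  case (one i)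
  have "rep u 1 = u" if "u \<in> U" for u using that by (rule rep_one)
  then have "expresses (Eq (Var (h i)) (Var 0)) (Suc i) h (\<lambda>e. e i = 1)" for h
    unfolding expresses_def by (auto) (metis rep_eq_iff)+
  then show ?case by blast
next
  case (indet i)
  have "expresses (Eq (Var (h i)) (numeral_term 1)) (Suc i) h (\<lambda>e. e i = \<X>)" for h
    unfolding expresses_def by (auto simp: rep_eq_iff rep_X_power vars_numeral_term simp del: numeral_term.simps)
  then show ?case by blast
next
  case (add i j k)
  have "expresses (Eq (Add (Var (h i)) (Var (h j))) (Var (h k))) (Suc (max i (max j k))) h (\<lambda>e. e i + e j = e k)" for h
    unfolding expresses_def by (auto simp: rep_eq_iff rep_add[symmetric])
  then show ?case by blast
next
  case (mult i j k)
  have "expresses (Eq (Mul (Var (h i)) (Var (h j))) (Mul (Var 0) (Var (h k)))) (Suc (max i (max j k))) h (\<lambda>e. e i * e j = e k)" for h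
    unfolding expresses_def by (auto simp: rep_eq_iff_mult)
  then show ?case by blast
next
  case (neg P)
  have "expresses (Neg \<phi>) N h (\<lambda>e. \<not> P e)" if "expresses \<phi> N h P" for \<phi> N h
    using that unfolding expresses_def by simp
  then show ?case using neg.IH by meson
next
  case (conj P Q)
  then obtain M N where M: "\<And>h. \<forall>i. h i \<noteq> 0 \<Longrightarrow> \<exists>\<phi>. expresses \<phi> M h P"
    and N: "\<And>h. \<forall>i. h i \<noteq> 0 \<Longrightarrow> \<exists>\<phi>. expresses \<phi> N h Q"
    by meson
  have "\<exists>\<chi>. expresses \<chi> (max M N) h (\<lambda>e. P e \<and> Q e)" if h: "\<forall>i. h i \<noteq> 0" for h
  proof -
    obtain \<phi> \<psi> where \<phi>: "expresses \<phi> M h P" and \<psi>: "expresses \<psi> N h Q" using M[OF h] N[OF h] by blast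
    have "h ` {..<M} \<subseteq> h ` {..<max M N}" "h ` {..<N} \<subseteq> h ` {..<max M N}"
      by (intro image_mono; simp)+
    then have "free_vars (Conj \<phi> \<psi>) \<subseteq> {0} \<union> h ` {..<max M N}"
      using \<phi> \<psi> unfolding expresses_def free_vars.simps by blast
    moreover have "sat A E (Conj \<phi> \<psi>) \<longleftrightarrow> P e \<and> Q e"
      if "E 0 \<in> U" "\<forall>i<max M N. E (h i) = rep (E 0) (e i)" for E e
    proof -
      have "sat A E \<phi> \<longleftrightarrow> P e" "sat A E \<psi> \<longleftrightarrow> Q e"
        using \<phi> \<psi> that unfolding expresses_def by simp_all
      then show ?thesis by simp
    qed
    ultimately show ?thesis unfolding expresses_def by blast
  qed
  then show ?case by blast
next
  case (ex P)
  then obtain N where N: "\<And>h. \<forall>i. h i \<noteq> 0 \<Longrightarrow> \<exists>\<phi>. expresses \<phi> N h P"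
    by blast
  have "\<exists>\<phi>. expresses \<phi> N h (\<lambda>e. \<exists>p. P (case_nat p e))" if h: "\<forall>i. h i \<noteq> 0" for h
  proof -
    \<comment> \<open>A fresh variable for the quantified polynomial, distinct from 0 and from the
      variables of the first \<open>N\<close> polynomials.\<close>
    define M where "M = Suc (Max (insert 0 (h ` {..<N})))"
    have M0: "M \<noteq> 0" by (simp add: M_def)
    have M: "h i \<noteq> M" if "i < N" for i
    proof -
      have "h i \<le> Max (insert 0 (h ` {..<N}))" using that by (intro Max_ge) auto
      then show ?thesis by (simp add: M_def)
    qed
    have "\<forall>i. case_nat M h i \<noteq> 0" using h M0 by (auto split: nat.split)
    from N[OF this] obtain \<phi> where \<phi>: "expresses \<phi> N (case_nat M h) P" by blast
    let ?\<psi> = "Exists M (Conj (Eq (Mul (Var M) (Var 0)) (Mul (Var 0) (Var M))) \<phi>)"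
    have "case_nat M h ` {..<N} \<subseteq> insert M (h ` {..<N})"
      by (auto split: nat.split)
    then have "free_vars ?\<psi> \<subseteq> {0} \<union> h ` {..<N}"
      using \<phi> unfolding expresses_def free_vars.simps vars_term.simps by blast
    moreover have "sat A E ?\<psi> \<longleftrightarrow> (\<exists>p. P (case_nat p e))"
      if E: "E 0 \<in> U" "\<forall>i<N. E (h i) = rep (E 0) (e i)" for E e
    proof -
      have "sat A E ?\<psi> \<longleftrightarrow> (\<exists>a\<in>A. a * E 0 = E 0 * a \<and> sat A (E(M := a)) \<phi>)"
        using M0 by simp
      also have "\<dots> \<longleftrightarrow> (\<exists>p. sat A (E(M := rep (E 0) p)) \<phi>)"
        by (rule ex_rep_iff[OF E(1)])
      also have "\<dots> \<longleftrightarrow> (\<exists>p. P (case_nat p e))"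
      proof -
        have "sat A (E(M := rep (E 0) p)) \<phi> \<longleftrightarrow> P (case_nat p e)" for p
        proof -
          have "(E(M := rep (E 0) p)) 0 = E 0" using M0 by simp
          moreover have "\<forall>i<N. (E(M := rep (E 0) p)) (case_nat M h i) = rep (E 0) (case_nat p e i)"
            using E(2) M by (auto split: nat.split dest: Suc_lessD)
          ultimately show ?thesis using \<phi> E(1) unfolding expresses_def by metis
        qed
        then show ?thesis by simp
      qed
      finally show ?thesis .
    qed
    ultimately show ?thesis unfolding expresses_def by blast
  qed
  then show ?case by blast
qed

section \<open>Diagonalization\<close>

definition diagonal :: "rformula \<Rightarrow> nat \<Rightarrow> rformula" where
  "diagonal \<phi> n = Exists 0 (Conj \<gamma> (Exists 1 (Conj (Eq (Var 1) (numeral_term n)) \<phi>)))"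

text \<open>The number \<open>n\<close> occurs twice, as the numeral and as the code of the formula
  it is fed to. Since \<open>diagonal\<close> binds the numeral by an equation, no syntactic
  substitution has to be arithmetized.\<close>

definition diagonal_code :: "nat \<Rightarrow> nat" where
  "diagonal_code n = prod_encode (3, prod_encode (0, prod_encode (2, prod_encode (code \<gamma>,
    prod_encode (3, prod_encode (1, prod_encode (2, prod_encode (prod_encode (0,
      prod_encode (code_term (Var 1), code_term (numeral_term n))), n))))))))"

lemma code_diagonal: "code (diagonal \<phi> (code \<phi>)) = diagonal_code (code \<phi>)"
  by (simp add: diagonal_def diagonal_code_def)

lemma definable_nat_diagonal_code: "definable_nat f \<Longrightarrow> definable_nat (\<lambda>e. diagonal_code (f e))"
  unfolding diagonal_code_def
  by (intro definable_nat_prod_encode definable_nat_code_numeral_term definable_nat_const)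

theorem undecidable: "\<not> decidable_theory (elementary_theory A)"
proof
  let ?T = "elementary_theory A"
  assume "decidable_theory ?T"
  then obtain f where f: "recursive 1 f" "\<And>n. f [n] = (if n \<in> code ` ?T then 1 else 0)"
    unfolding decidable_theory_def decidable_def by blast
  have "definable_nat (\<lambda>e. f (map (\<lambda>g. g e) [\<lambda>e::nat \<Rightarrow> 'k poly. diagonal_code (exponent (e 0))]))"
    by (rule definable_nat_recursive[OF f(1)])
      (auto intro: definable_nat_diagonal_code definable_nat_exponent)
  \<comment> \<open>The relation to be diagonalized: the decision procedure rejects the diagonal
    sentence of the formula coded by the exponent of variable 0.\<close>
  then have "definable (\<lambda>e::nat \<Rightarrow> 'k poly. \<not> f [diagonal_code (exponent (e 0))] = 1)"
    by (intro definable.neg definable_nat_eq definable_nat_const) simp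
  from definable_imp_expresses[OF this] obtain N where N:
    "\<And>h. \<forall>i. h i \<noteq> 0 \<Longrightarrow> \<exists>\<phi>. expresses \<phi> N h (\<lambda>e. \<not> f [diagonal_code (exponent (e 0))] = 1)"
    by blast
  have "\<exists>\<phi>. expresses \<phi> N (\<lambda>_. 1) (\<lambda>e. \<not> f [diagonal_code (exponent (e 0))] = 1)"
    by (rule N) simp
  then obtain \<phi> where \<phi>: "expresses \<phi> N (\<lambda>_. 1) (\<lambda>e. \<not> f [diagonal_code (exponent (e 0))] = 1)" ..
  define D where "D = diagonal \<phi> (code \<phi>)"
  \<comment> \<open>\<open>D\<close> asserts that the procedure rejects the code of
    \<open>D\<close>, and the procedure is correct.\<close>
  have D_sat: "sat A E D \<longleftrightarrow> D \<notin> ?T" for E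
  proof -
    have num: "rep u (\<X> ^ n) \<in> A" if "u \<in> U" for u n
      using bij_rep[OF that] by (auto simp: bij_betw_def)
    have eval: "eval_term (E(0 := u, Suc 0 := a)) (numeral_term n) = rep u (\<X> ^ n)" if "u \<in> U" for u a n
      using that by (intro rep_X_power) auto
    have "sat A E D \<longleftrightarrow> (\<exists>u\<in>U. \<exists>a\<in>A. a = rep u (\<X> ^ code \<phi>) \<and> sat A (E(0 := u, 1 := a)) \<phi>)"
      using U unfolding D_def diagonal_def by (auto simp: sat_\<gamma> eval)
    also have "\<dots> \<longleftrightarrow> (\<exists>u\<in>U. sat A (E(0 := u, 1 := rep u (\<X> ^ code \<phi>))) \<phi>)"
      using num by auto
    also have "\<dots> \<longleftrightarrow> (\<exists>u\<in>U. \<not> f [diagonal_code (code \<phi>)] = 1)"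
    proof (rule bex_cong)
      fix u assume u: "u \<in> U"
      let ?E = "E(0 := u, 1 := rep u (\<X> ^ code \<phi>))"
      have "?E 0 \<in> U" "\<forall>i<N. ?E 1 = rep (?E 0) (\<X> ^ code \<phi>)" using u by auto
      \<comment> \<open>All polynomial variables sit in variable 1, so the matching environment is
        constant.\<close>
      then have "sat A ?E \<phi> \<longleftrightarrow> \<not> f [diagonal_code (exponent (\<X> ^ code \<phi> :: 'k poly))] = 1"
        using \<phi> unfolding expresses_def by (elim conjE allE[of _ ?E] allE[of _ "\<lambda>_. \<X> ^ code \<phi>"]) blast
      then show "sat A ?E \<phi> \<longleftrightarrow> \<not> f [diagonal_code (code \<phi>)] = 1" by simp
    qed simp
    also have "\<dots> \<longleftrightarrow> code D \<notin> code ` ?T"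
      using U by (auto simp: f(2) code_diagonal D_def)
    finally show ?thesis by (auto simp: code_inject)
  qed
  have "sentence D"
    using \<phi> free_vars_\<gamma> by (auto simp: expresses_def D_def diagonal_def sentence_def vars_numeral_term)
  then have "D \<in> ?T \<longleftrightarrow> (\<forall>E::nat \<Rightarrow> 'a. range E \<subseteq> A \<longrightarrow> D \<notin> ?T)"
    by (subst elementary_theory_def) (simp add: D_sat)
  \<comment> \<open>There is an assignment into \<open>A\<close>, so truth under all assignments is
    not vacuous.\<close>
  moreover have "range (\<lambda>_::nat. 0) \<subseteq> A" using zero by auto
  ultimately show False by blast
qed

end

section \<open>Centralizers in the free associative algebra\<close>

abbreviation coef :: "('x word \<Rightarrow>\<^sub>0 'k::zero) \<Rightarrow> 'x list \<Rightarrow> 'k" where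
  "coef f w \<equiv> Poly_Mapping.lookup f (Word w)"

abbreviation scalar :: "'k::zero \<Rightarrow> 'x word \<Rightarrow>\<^sub>0 'k" where
  "scalar c \<equiv> Poly_Mapping.single 0 c"

lemma word_poly_eqI: "(\<And>w. coef f w = coef g w) \<Longrightarrow> f = g"
  by (rule poly_mapping_eqI) (metis word.exhaust)

text \<open>A factorization of a word is a cut into prefix and suffix, so the convolution is a
  finite sum over cut positions.\<close>

lemma coef_mult:
  "coef (f * g) w = (\<Sum>i\<le>length w. coef f (take i w) * coef g (drop i w))"
proof -
  let ?t = "\<lambda>i. Word (take i w)"
  have inner: "(\<Sum>r. (Poly_Mapping.lookup g r when Word w = q + r)) =
      (if q \<in> ?t ` {..length w} then coef g (drop (length (letters q)) w) else 0)" for q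
  proof (cases "q \<in> ?t ` {..length w}")
    case True
    then obtain i where i: "q = ?t i" "i \<le> length w" by auto
    have "Word w = q + r \<longleftrightarrow> Word (drop i w) = r" for r
    proof (cases r)
      case (Word v)
      have "w = take i w @ v \<longleftrightarrow> drop i w = v" by (metis append_take_drop_id same_append_eq)
      then show ?thesis by (simp add: i plus_word_def Word)
    qed
    then show ?thesis using True i by (simp add: min_def)
  next
    case False
    have "Word w \<noteq> q + r" for r
    proof
      assume "Word w = q + r"
      then have "q = ?t (length (letters q))" "length (letters q) \<le> length w"
        by (cases q; simp add: plus_word_def)+
      then show False using False by blast
    qed
    then show ?thesis using False by simp
  qed
  have inj: "inj_on ?t {..length w}"
    by (rule inj_onI) (metis atMost_iff length_take min.absorb2 word.inject)
  have "coef (f * g) w = Sum_any (\<lambda>q. Poly_Mapping.lookup f q *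
      (if q \<in> ?t ` {..length w} then coef g (drop (length (letters q)) w) else 0))"
    by (simp add: lookup_mult inner)
  also have "\<dots> = (\<Sum>q\<in>?t ` {..length w}. Poly_Mapping.lookup f q *
      (if q \<in> ?t ` {..length w} then coef g (drop (length (letters q)) w) else 0))"
    by (rule Sum_any.expand_superset) auto
  also have "\<dots> = (\<Sum>i\<le>length w. coef f (take i w) * coef g (drop i w))"
    by (subst sum.reindex[OF inj]) (auto intro!: sum.cong simp: min_def)
  finally show ?thesis .
qed

text \<open>A cut at any position other than the end of \<open>x\<close> makes the prefix or the
  suffix too long for its factor.\<close>

lemma coef_mult_top:
  fixes f g :: "'x word \<Rightarrow>\<^sub>0 'k::field"
  assumes "\<And>v. coef f v \<noteq> 0 \<Longrightarrow> length v \<le> length x" "\<And>v. coef g v \<noteq> 0 \<Longrightarrow> length v \<le> length y"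
  shows "coef (f * g) (x @ y) = coef f x * coef g y"
proof -
  have "coef f (take i (x @ y)) * coef g (drop i (x @ y)) = 0"
    if "i \<le> length (x @ y)" "i \<noteq> length x" for i
  proof (cases "i < length x")
    case True
    then have "coef g (drop i (x @ y)) = 0" using assms(2)[of "drop i (x @ y)"] by fastforce
    then show ?thesis by simp
  next
    case False
    then have "coef f (take i (x @ y)) = 0" using assms(1)[of "take i (x @ y)"] that by fastforce
    then show ?thesis by simp
  qed
  then have "coef (f * g) (x @ y) = (\<Sum>i\<in>{length x}. coef f (take i (x @ y)) * coef g (drop i (x @ y)))"
    unfolding coef_mult by (intro sum.mono_neutral_right) auto
  then show ?thesis by simp
qed

lemma coef_scalar: "coef (scalar c) w = (if w = [] then c else 0)"
  by (simp add: lookup_single when_def zero_word_def)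

lemma coef_scalar_mult: "coef (scalar c * f) w = c * coef f w"
proof -
  have "coef (scalar c * f) w = (\<Sum>i\<in>{0}. coef (scalar c) (take i w) * coef f (drop i w))"
    unfolding coef_mult by (rule sum.mono_neutral_right) (auto simp: coef_scalar)
  then show ?thesis by (simp add: coef_scalar)
qed

lemma scalar_commute:
  fixes f :: "'x word \<Rightarrow>\<^sub>0 'k::field"
  shows "f * scalar c = scalar c * f"
proof (rule word_poly_eqI)
  fix w
  have "coef (f * scalar c) w = (\<Sum>i\<in>{length w}. coef f (take i w) * coef (scalar c) (drop i w))"
    unfolding coef_mult by (rule sum.mono_neutral_right) (auto simp: coef_scalar)
  then show "coef (f * scalar c) w = coef (scalar c * f) w"
    by (simp add: coef_scalar coef_scalar_mult mult.commute)
qed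

text \<open>For \<open>f = 0\<close> this is \<open>Max\<close> of the empty set; attainment is
  therefore stated for nonzero \<open>f\<close> only.\<close>

definition word_degree :: "('x word \<Rightarrow>\<^sub>0 'k::zero) \<Rightarrow> nat" where
  "word_degree f = Max ((\<lambda>w. length (letters w)) ` Poly_Mapping.keys f)"

lemma le_word_degree: "coef f w \<noteq> 0 \<Longrightarrow> length w \<le> word_degree f"
proof -
  assume "coef f w \<noteq> 0"
  then have "Word w \<in> Poly_Mapping.keys f" by (simp add: in_keys_iff)
  then have "length (letters (Word w)) \<le> word_degree f"
    unfolding word_degree_def by (intro Max_ge imageI) simp_all
  then show ?thesis by simp
qed

lemma word_degree_attained:
  assumes "f \<noteq> 0"
  obtains w where "length w = word_degree f" "coef f w \<noteq> 0"
proof -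
  have "Poly_Mapping.keys f \<noteq> {}" using assms by simp
  then have "word_degree f \<in> (\<lambda>w. length (letters w)) ` Poly_Mapping.keys f"
    unfolding word_degree_def by (intro Max_in) auto
  then obtain v where v: "word_degree f = length (letters v)" "v \<in> Poly_Mapping.keys f" by blast
  then have "length (letters v) = word_degree f" "coef f (letters v) \<noteq> 0" by (simp_all add: in_keys_iff)
  then show thesis by (rule that)
qed

lemma word_degree_le: "f \<noteq> 0 \<Longrightarrow> (\<And>w. coef f w \<noteq> 0 \<Longrightarrow> length w \<le> n) \<Longrightarrow> word_degree f \<le> n"
  by (metis word_degree_attained)

text \<open>Concatenate words of top degree of f and g: the coefficient there is the product of two
  nonzero scalars.\<close>

lemma
  fixes f g :: "'x word \<Rightarrow>\<^sub>0 'k::field"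
  assumes "f \<noteq> 0" "g \<noteq> 0"
  shows word_poly_mult_nonzero: "f * g \<noteq> 0"
    and word_degree_mult: "word_degree (f * g) = word_degree f + word_degree g"
proof -
  obtain x y where x: "length x = word_degree f" "coef f x \<noteq> 0"
    and y: "length y = word_degree g" "coef g y \<noteq> 0"
    using assms by (metis word_degree_attained)
  have "coef (f * g) (x @ y) = coef f x * coef g y"
    by (rule coef_mult_top) (simp_all add: x y le_word_degree)
  then have nz: "coef (f * g) (x @ y) \<noteq> 0" using x y by simp
  then show "f * g \<noteq> 0" by auto
  moreover have "length w \<le> word_degree f + word_degree g" if w: "coef (f * g) w \<noteq> 0" for w
  proof -
    obtain i where i: "i \<in> {..length w}" "coef f (take i w) * coef g (drop i w) \<noteq> 0"
      by (rule sum.not_neutral_contains_not_neutral[OF w[unfolded coef_mult]])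
    then have "length (take i w) + length (drop i w) \<le> word_degree f + word_degree g"
      by (intro add_mono le_word_degree) auto
    then show ?thesis using i by simp
  qed
  ultimately have "word_degree (f * g) \<le> word_degree f + word_degree g" by (intro word_degree_le)
  moreover have "word_degree f + word_degree g \<le> word_degree (f * g)"
    using le_word_degree[OF nz] x y by simp
  ultimately show "word_degree (f * g) = word_degree f + word_degree g" by simp
qed

lemma word_poly_mult_left_cancel:
  fixes f g h :: "'x word \<Rightarrow>\<^sub>0 'k::field"
  assumes "f \<noteq> 0" "f * g = f * h"
  shows "g = h"
proof (rule ccontr)
  assume "g \<noteq> h"
  then have "f * (g - h) \<noteq> 0" using assms(1) by (intro word_poly_mult_nonzero) auto
  then show False using assms(2) by (simp add: right_diff_distrib)
qed

text \<open>Comparing coefficients of \<open>a u = u a\<close> at words \<open>x w\<close> of top degree gives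
  \<open>a(x) u(w) = u(x) a(w)\<close>.\<close>

lemma commute_top_proportional:
  fixes a u :: "'x word \<Rightarrow>\<^sub>0 'k::field"
  assumes "a * u = u * a" "u \<noteq> 0" "word_degree a = word_degree u"
  shows "\<exists>c. \<forall>w. length w = word_degree u \<longrightarrow> coef (a - scalar c * u) w = 0"
proof -
  obtain x where x: "length x = word_degree u" "coef u x \<noteq> 0"
    using assms(2) by (metis word_degree_attained)
  have "coef (a - scalar (coef a x / coef u x) * u) w = 0" if w: "length w = word_degree u" for w
  proof -
    have le: "coef a v \<noteq> 0 \<Longrightarrow> length v \<le> word_degree u" for v
      using le_word_degree[of a v] assms(3) by simp
    have "coef a x * coef u w = coef (a * u) (x @ w)"
      by (rule coef_mult_top[symmetric]) (simp_all add: x w le_word_degree le)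
    also have "\<dots> = coef u x * coef a w"
      unfolding assms(1) by (rule coef_mult_top) (simp_all add: x w le_word_degree le)
    finally show ?thesis using x by (simp add: lookup_minus coef_scalar_mult field_simps)
  qed
  then show ?thesis by blast
qed

section \<open>Polynomials evaluated at an element of the algebra\<close>

definition eval_at :: "('x word \<Rightarrow>\<^sub>0 'k::field) \<Rightarrow> 'k poly \<Rightarrow> 'x word \<Rightarrow>\<^sub>0 'k" where
  "eval_at u p = fold_coeffs (\<lambda>c r. scalar c + u * r) p 0"

lemma eval_at_0 [simp]: "eval_at u 0 = 0"
  by (simp add: eval_at_def)

lemma eval_at_pCons [simp]: "eval_at u (pCons c p) = scalar c + u * eval_at u p"
  by (cases "p = 0 \<and> c = 0") (auto simp: eval_at_def)

lemma eval_at_1 [simp]: "eval_at u 1 = 1"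
  by (simp add: one_pCons flip: single_one)

lemma eval_at_add: "eval_at u (p + q) = eval_at u p + eval_at u q"
  by (induction p q rule: poly_induct2) (simp_all add: single_add algebra_simps)

lemma eval_at_smult: "eval_at u (smult c p) = scalar c * eval_at u p"
proof (induction p)
  case (pCons a p)
  have "u * (scalar c * eval_at u p) = scalar c * (u * eval_at u p)"
    by (metis mult.assoc scalar_commute)
  then show ?case using pCons by (simp add: mult_single distrib_left)
qed simp

lemma eval_at_mult: "eval_at u (p * q) = eval_at u p * eval_at u q"
  by (induction p) (simp_all add: eval_at_add eval_at_smult distrib_right mult.assoc)

text \<open>\<open>u\<close> is itself the value of X, and polynomials commute.\<close>

lemma eval_at_commute: "eval_at u p * u = u * eval_at u p"
proof -
  have "eval_at u [:0, 1:] = u" by (simp flip: one_pCons)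
  then show ?thesis by (metis eval_at_mult mult.commute)
qed

lemma mult_eval_at_mult: "u * eval_at u p * (u * eval_at u q) = u * (u * eval_at u (p * q))"
proof -
  have "u * eval_at u p * (u * eval_at u q) = u * (eval_at u p * u) * eval_at u q"
    by (simp only: mult.assoc)
  then show ?thesis by (simp only: eval_at_commute eval_at_mult mult.assoc)
qed

lemma algebra0_coef_Nil: "a \<in> free_assoc_algebra0 X \<Longrightarrow> coef a [] = 0"
  unfolding free_assoc_algebra0_def using in_keys_iff[of "Word []" a] by auto

text \<open>Nonzero elements without constant term are transcendental over K: the coefficient at the
  empty word gives c = 0, then \<open>u\<close> cancels.\<close>

lemma eval_at_eq_0_iff:
  assumes u: "u \<in> free_assoc_algebra0 X" "u \<noteq> 0"
  shows "eval_at u p = 0 \<longleftrightarrow> p = 0"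
proof (induction p)
  case (pCons c p)
  show ?case
  proof
    assume *: "eval_at u (pCons c p) = 0"
    have "coef (u * eval_at u p) [] = 0"
      by (simp add: coef_mult algebra0_coef_Nil[OF u(1)])
    then have "c = 0" using arg_cong[OF *, of "\<lambda>f. coef f []"] by (simp add: lookup_add coef_scalar)
    then have "eval_at u p = 0" using * word_poly_mult_nonzero[OF u(2)] by auto
    then show "pCons c p = 0" using pCons.IH \<open>c = 0\<close> by simp
  qed simp
qed simp

lemma eval_at_eq_iff:
  assumes u: "u \<in> free_assoc_algebra0 X" "u \<noteq> 0"
  shows "eval_at u p = eval_at u q \<longleftrightarrow> p = q"
  using eval_at_eq_0_iff[OF u, of "p - q"] eval_at_add[of u "p - q" q] by auto

lemma scalar_mult_in_algebra0:
  assumes "a \<in> free_assoc_algebra0 X"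
  shows "scalar c * a \<in> free_assoc_algebra0 X"
proof -
  have "Poly_Mapping.keys (scalar c * a) \<subseteq> Poly_Mapping.keys a"
  proof
    fix w assume "w \<in> Poly_Mapping.keys (scalar c * a)"
    then have "coef (scalar c * a) (letters w) \<noteq> 0" by (simp add: in_keys_iff)
    then show "w \<in> Poly_Mapping.keys a" unfolding coef_scalar_mult by (auto simp: in_keys_iff)
  qed
  then show ?thesis using assms by (auto simp: free_assoc_algebra0_def)
qed

text \<open>\<open>eval_at u p\<close> may have a constant term; the factor \<open>u\<close> removes
  it.\<close>

lemma mult_eval_at_in_algebra0:
  assumes "u \<in> free_assoc_algebra0 X"
  shows "u * eval_at u p \<in> free_assoc_algebra0 X"
proof (induction p)
  case 0 then show ?case by (simp add: zero_in_free_assoc_algebra0)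
next
  case (pCons c p)
  then show ?case
    by (simp add: distrib_left scalar_commute assms add_in_free_assoc_algebra0
        mult_in_free_assoc_algebra0 scalar_mult_in_algebra0)
qed

lemma diff_scalar_mult_in_algebra0:
  fixes a u :: "'x word \<Rightarrow>\<^sub>0 'k::field"
  assumes "a \<in> free_assoc_algebra0 X" "u \<in> free_assoc_algebra0 X"
  shows "a - scalar c * u \<in> free_assoc_algebra0 X"
proof -
  have "a - scalar c * u = a + scalar (- c) * u" by (simp add: single_uminus)
  then show ?thesis using assms by (simp only: add_in_free_assoc_algebra0 scalar_mult_in_algebra0)
qed

section \<open>Centralizers of polynomial-like elements\<close>

definition centralizer0 :: "'x set \<Rightarrow> ('x word \<Rightarrow>\<^sub>0 'k::field) \<Rightarrow> ('x word \<Rightarrow>\<^sub>0 'k) set" where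
  "centralizer0 X u = {a \<in> free_assoc_algebra0 X. a * u = u * a}"

text \<open>Nonzero scalars are not elements of the algebra; \<open>c * d = u * u\<close> is a
  first-order substitute for c being a nonzero scalar multiple of u.\<close>

definition polynomial_like :: "'x set \<Rightarrow> ('x word \<Rightarrow>\<^sub>0 'k::field) \<Rightarrow> bool" where
  "polynomial_like X u \<longleftrightarrow> u \<noteq> 0 \<and>
    (\<forall>a\<in>centralizer0 X u. \<exists>b\<in>centralizer0 X u. a * a = u * b) \<and>
    (\<forall>a\<in>centralizer0 X u. \<exists>c\<in>centralizer0 X u. \<exists>b\<in>centralizer0 X u.
      a = c + u * b \<and> (c = 0 \<or> (\<exists>d\<in>centralizer0 X u. c * d = u * u)))"

lemma mult_eval_at_in_centralizer0:
  assumes "u \<in> free_assoc_algebra0 X"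
  shows "u * eval_at u p \<in> centralizer0 X u"
  using mult_eval_at_in_algebra0[OF assms] by (simp add: centralizer0_def mult.assoc eval_at_commute)

lemma centralizer0_polynomial_like:
  fixes u :: "'x word \<Rightarrow>\<^sub>0 'k::field"
  assumes u: "u \<in> free_assoc_algebra0 X" and good: "polynomial_like X u"
  shows "centralizer0 X u = range (\<lambda>p. u * eval_at u p)"
proof -
  let ?C = "centralizer0 X u"
  have u0: "u \<noteq> 0" and sq: "\<And>a. a \<in> ?C \<Longrightarrow> \<exists>b\<in>?C. a * a = u * b"
    and split: "\<And>a. a \<in> ?C \<Longrightarrow> \<exists>c\<in>?C. \<exists>b\<in>?C. a = c + u * b \<and> (c = 0 \<or> (\<exists>d\<in>?C. c * d = u * u))"
    using good unfolding polynomial_like_def by blast+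
  have uC: "u \<in> ?C" using u by (simp add: centralizer0_def)
  \<comment> \<open>Let m have least degree in the centralizer. From m m = u b and deg b at least
    deg m it follows that deg u is at most deg m.\<close>
  have min: "word_degree u \<le> word_degree a" if a: "a \<in> ?C" "a \<noteq> 0" for a
  proof -
    obtain m where m: "m \<in> ?C" "m \<noteq> 0" "\<And>b. b \<in> ?C \<Longrightarrow> b \<noteq> 0 \<Longrightarrow> word_degree m \<le> word_degree b"
      using ex_has_least_nat[of "\<lambda>b. b \<in> ?C \<and> b \<noteq> 0" a word_degree] a by blast
    obtain b where b: "b \<in> ?C" "m * m = u * b" using sq[OF m(1)] by blast
    have "b \<noteq> 0" using b(2) word_poly_mult_nonzero[OF m(2) m(2)] by auto
    then have "word_degree m + word_degree m = word_degree u + word_degree b"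
      using b(2) m(2) u0 by (metis word_degree_mult)
    then have "word_degree u \<le> word_degree m" using m(3)[OF b(1) \<open>b \<noteq> 0\<close>] by simp
    then show ?thesis using m(3)[OF a] by simp
  qed
  have upos: "word_degree u > 0"
  proof -
    obtain w where w: "length w = word_degree u" "coef u w \<noteq> 0" using u0 by (metis word_degree_attained)
    then have "w \<noteq> []" using algebra0_coef_Nil[OF u] by auto
    then show ?thesis by (simp flip: w(1))
  qed
  \<comment> \<open>Minimality and c d = u u force deg c = deg u. Subtracting a suitable multiple of
    u cancels the top coefficients, and minimality makes the remainder 0.\<close>
  have scal: "\<exists>k. c = scalar k * u" if c: "c \<in> ?C" "c = 0 \<or> (\<exists>d\<in>?C. c * d = u * u)" for c
  proof (cases "c = 0")
    case True
    then show ?thesis by (intro exI[of _ 0]) simp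
  next
    case False
    then obtain d where d: "d \<in> ?C" "c * d = u * u" using c by blast
    then have "d \<noteq> 0" using word_poly_mult_nonzero[OF u0 u0] by auto
    then have "word_degree c + word_degree d = word_degree u + word_degree u"
      using False d(2) u0 by (metis word_degree_mult)
    then have deg: "word_degree c = word_degree u"
      using min[OF c(1) False] min[OF d(1) \<open>d \<noteq> 0\<close>] by simp
    obtain k where k: "\<And>w. length w = word_degree u \<Longrightarrow> coef (c - scalar k * u) w = 0"
      using commute_top_proportional[OF _ u0 deg] c(1) by (auto simp: centralizer0_def)
    let ?r = "c - scalar k * u"
    have "u * (scalar k * u) = scalar k * u * u"
      by (simp only: scalar_commute flip: mult.assoc)
    then have "?r * u = u * ?r"
      using c(1) by (simp add: centralizer0_def left_diff_distrib right_diff_distrib)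
    then have rC: "?r \<in> ?C"
      using c(1) u by (simp add: centralizer0_def diff_scalar_mult_in_algebra0)
    have "?r = 0"
    proof (rule ccontr)
      assume nz: "?r \<noteq> 0"
      have "word_degree ?r \<le> word_degree u"
      proof (rule word_degree_le[OF nz])
        fix w assume "coef ?r w \<noteq> 0"
        then have "coef c w \<noteq> 0 \<or> coef u w \<noteq> 0" by (auto simp: lookup_minus coef_scalar_mult)
        then show "length w \<le> word_degree u" using deg le_word_degree by metis
      qed
      with min[OF rC nz] have "word_degree ?r = word_degree u" by simp
      then show False using word_degree_attained[OF nz] k by metis
    qed
    then show ?thesis by (intro exI[of _ k]) simp
  qed
  \<comment> \<open>Descent on the degree: in a = k u + u b the element b has smaller degree or is
    0, and k becomes the next coefficient of p.\<close>
  have "\<exists>p. a = u * eval_at u p" if "a \<in> ?C" for a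
    using that
  proof (induction "word_degree a" arbitrary: a rule: less_induct)
    case less
    obtain c b where cb: "c \<in> ?C" "b \<in> ?C" "a = c + u * b" "c = 0 \<or> (\<exists>d\<in>?C. c * d = u * u)"
      using split[OF less.prems] by blast
    obtain k where k: "c = scalar k * u" using scal[OF cb(1,4)] by blast
    have "\<exists>q. b = u * eval_at u q"
    proof (cases "b = 0")
      case True
      then show ?thesis by (intro exI[of _ 0]) simp
    next
      case False
      have ub: "u * b \<noteq> 0" "word_degree (u * b) = word_degree u + word_degree b"
        using word_poly_mult_nonzero[OF u0 False] word_degree_mult[OF u0 False] by auto
      have b0: "word_degree u \<le> word_degree b" by (rule min[OF cb(2) False])
      obtain w where w: "length w = word_degree (u * b)" "coef (u * b) w \<noteq> 0"
        using ub(1) by (metis word_degree_attained)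
      \<comment> \<open>A top word of u b is longer than every word of u, so the summand k u cannot
        cancel it in a.\<close>
      have "\<not> length w \<le> word_degree u" using w ub b0 upos by simp
      then have "coef u w = 0" using le_word_degree by metis
      then have "coef a w \<noteq> 0" using w by (simp add: cb(3) k lookup_add coef_scalar_mult)
      then have "word_degree b < word_degree a" using le_word_degree[of a w] w ub upos by simp
      then show ?thesis using less.hyps cb(2) by blast
    qed
    then obtain q where "b = u * eval_at u q" by blast
    then have "a = u * eval_at u (pCons k q)"
      by (simp add: cb(3) k distrib_left scalar_commute)
    then show ?case by blast
  qed
  then show ?thesis using mult_eval_at_in_centralizer0[OF u] by auto
qed

section \<open>Letters are polynomial-like\<close>

lemma coef_letter_mult:
  fixes f :: "'x word \<Rightarrow>\<^sub>0 'k::field"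
  shows "coef (Poly_Mapping.single (Word [x]) 1 * f) w =
    (case w of [] \<Rightarrow> 0 | y # v \<Rightarrow> if y = x then coef f v else 0)"
proof (cases w)
  case (Cons y v)
  have "coef (Poly_Mapping.single (Word [x]) 1 * f) w =
      (\<Sum>i\<in>{1}. coef (Poly_Mapping.single (Word [x]) 1) (take i w) * coef f (drop i w))"
    unfolding coef_mult
    by (rule sum.mono_neutral_right) (use Cons in \<open>auto simp: lookup_single when_def take_Cons split: nat.splits\<close>)
  then show ?thesis using Cons by (simp add: lookup_single when_def)
qed (simp add: coef_mult lookup_single)

lemma coef_mult_letter:
  fixes f :: "'x word \<Rightarrow>\<^sub>0 'k::field"
  shows "coef (f * Poly_Mapping.single (Word [x]) 1) (v @ [x]) = coef f v"
proof -
  have "coef (f * Poly_Mapping.single (Word [x]) 1) (v @ [x]) =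
      (\<Sum>i\<in>{length v}. coef f (take i (v @ [x])) * coef (Poly_Mapping.single (Word [x]) 1) (drop i (v @ [x])))"
    unfolding coef_mult
  proof (rule sum.mono_neutral_right)
    show "\<forall>i\<in>{..length (v @ [x])} - {length v}.
        coef f (take i (v @ [x])) * coef (Poly_Mapping.single (Word [x]) 1) (drop i (v @ [x])) = 0"
    proof
      fix i assume i: "i \<in> {..length (v @ [x])} - {length v}"
      have "[x] \<noteq> drop i (v @ [x])"
      proof
        assume "[x] = drop i (v @ [x])"
        then have "length [x] = length (drop i (v @ [x]))" by (rule arg_cong)
        then show False using i by auto
      qed
      then have "coef (Poly_Mapping.single (Word [x]) (1 :: 'k)) (drop i (v @ [x])) = 0"
        by (simp only: lookup_single when_def word.inject if_False)
      then show "coef f (take i (v @ [x])) * coef (Poly_Mapping.single (Word [x]) 1) (drop i (v @ [x])) = 0"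
        by simp
    qed
  qed auto
  then show ?thesis by simp
qed

lemma coef_eval_at_letter:
  "coef (eval_at (Poly_Mapping.single (Word [x]) 1) p) w =
    (if w = replicate (length w) x then coeff p (length w) else (0 :: 'k::field))"
proof (induction p arbitrary: w)
  case (pCons c p)
  show ?case
    by (cases w) (simp_all add: lookup_add coef_scalar coef_letter_mult pCons.IH)
qed simp

text \<open>Commutation equates the coefficient at y v x^k with that at v x^(k+1) if y = x, and
  makes it 0 otherwise. Moving letters from the front to the end shows that all of them are x; k
  counts the letters moved.\<close>

lemma commute_letter_coef:
  fixes a :: "'x word \<Rightarrow>\<^sub>0 'k::field"
  assumes comm: "a * Poly_Mapping.single (Word [x]) 1 = Poly_Mapping.single (Word [x]) 1 * a"
    and "coef a (w @ replicate k x) \<noteq> 0"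
  shows "w = replicate (length w) x"
  using assms(2)
proof (induction w arbitrary: k)
  case (Cons y v)
  have "coef a (y # v @ replicate k x) = coef (a * Poly_Mapping.single (Word [x]) 1) ((y # v @ replicate k x) @ [x])"
    by (simp only: coef_mult_letter)
  also have "\<dots> = (if y = x then coef a (v @ replicate (Suc k) x) else 0)"
    unfolding comm by (simp add: coef_letter_mult replicate_append_same)
  finally have "y = x" "coef a (v @ replicate (Suc k) x) \<noteq> 0"
    using Cons.prems by (auto split: if_splits)
  then show ?case using Cons.IH[of "Suc k"] by simp
qed simp

lemma commute_letter:
  fixes a :: "'x word \<Rightarrow>\<^sub>0 'k::field"
  assumes "a * Poly_Mapping.single (Word [x]) 1 = Poly_Mapping.single (Word [x]) 1 * a"
  shows "\<exists>p. a = eval_at (Poly_Mapping.single (Word [x]) 1) p"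
proof -
  \<comment> \<open>Only powers of x occur in a, and their coefficients are those of p.\<close>
  define p where "p = (\<Sum>n\<le>word_degree a. monom (coef a (replicate n x)) n)"
  have coeff_p: "coeff p n = coef a (replicate n x)" for n
    using le_word_degree[of a "replicate n x"] by (auto simp: p_def coeff_sum)
  have "coef a w = coef (eval_at (Poly_Mapping.single (Word [x]) 1) p) w" for w
    using commute_letter_coef[OF assms, of w 0] by (auto simp: coef_eval_at_letter coeff_p)
  then show ?thesis using word_poly_eqI by blast
qed

lemma polynomial_like_letter:
  assumes "x \<in> X"
  shows "polynomial_like X (Poly_Mapping.single (Word [x]) (1 :: 'k::field))"
    and "Poly_Mapping.single (Word [x]) (1 :: 'k) \<in> free_assoc_algebra0 X"
proof -
  let ?u = "Poly_Mapping.single (Word [x]) (1 :: 'k)"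
  show u: "?u \<in> free_assoc_algebra0 X" using assms by (simp add: free_assoc_algebra0_def)
  have u0: "?u \<noteq> 0" by (metis lookup_single_eq lookup_zero one_neq_zero)
  have C: "\<exists>p. a = ?u * eval_at ?u p" if "a \<in> centralizer0 X ?u" for a
  proof -
    have a: "a \<in> free_assoc_algebra0 X" "a * ?u = ?u * a" using that by (simp_all add: centralizer0_def)
    obtain p where p: "a = eval_at ?u p" using commute_letter[OF a(2)] by blast
    obtain c q where cq: "p = pCons c q" by (cases p)
    \<comment> \<open>Elements of the algebra have no constant term, so a factor X splits off
      p.\<close>
    have "c = 0"
      using algebra0_coef_Nil[OF a(1)] coef_eval_at_letter[of x p "[]"] by (simp add: p cq)
    then show ?thesis using p cq by auto
  qed
  note in_C = mult_eval_at_in_centralizer0[OF u]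
  show "polynomial_like X ?u"
    unfolding polynomial_like_def
  proof (intro conjI ballI u0)
    fix a assume "a \<in> centralizer0 X ?u"
    then obtain p where p: "a = ?u * eval_at ?u p" using C by blast
    have "a * a = ?u * (?u * eval_at ?u (p * p))"
      unfolding p by (rule mult_eval_at_mult)
    then show "\<exists>b\<in>centralizer0 X ?u. a * a = ?u * b" using in_C by blast
    obtain c q where cq: "p = pCons c q" by (cases p)
    \<comment> \<open>The constant coefficient of p gives the summand c u; its cofactor in u u is
      the multiple of u by the inverse of c.\<close>
    have "a = ?u * eval_at ?u [:c:] + ?u * (?u * eval_at ?u q)"
      by (simp add: p cq distrib_left)
    moreover have "?u * eval_at ?u [:c:] = 0 \<or> (\<exists>d\<in>centralizer0 X ?u. (?u * eval_at ?u [:c:]) * d = ?u * ?u)"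
    proof (cases "c = 0")
      case False
      have "(?u * eval_at ?u [:c:]) * (?u * eval_at ?u [:inverse c:]) = ?u * (?u * eval_at ?u ([:c:] * [:inverse c:]))"
        by (rule mult_eval_at_mult)
      also have "[:c:] * [:inverse c:] = 1"
        using False by (simp add: one_pCons)
      finally show ?thesis using in_C[of "[:inverse c:]"] by (auto simp only: eval_at_1 mult_1_right)
    qed simp
    ultimately show "\<exists>c\<in>centralizer0 X ?u. \<exists>b\<in>centralizer0 X ?u.
        a = c + ?u * b \<and> (c = 0 \<or> (\<exists>d\<in>centralizer0 X ?u. c * d = ?u * ?u))"
      using in_C by blast
  qed
qed

section \<open>A formula defining polynomial-like elements, and the conclusion\<close>

definition exists_commuting :: "nat \<Rightarrow> rformula \<Rightarrow> rformula" where
  "exists_commuting i \<phi> = Exists i (Conj (Eq (Mul (Var i) (Var 0)) (Mul (Var 0) (Var i))) \<phi>)"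

text \<open>Variable 0 is u. Variables 1, 2 are a, b in the square condition, and 1, 2, 3, 4 are a,
  c, b, d in the splitting condition; universal quantifiers and the disjunction are spelled with
  \<open>Neg\<close>.\<close>

definition polynomial_like_formula :: rformula where
  "polynomial_like_formula = Conj (Neg (Eq (Var 0) Zero)) (Conj
    (Neg (exists_commuting 1 (Neg (exists_commuting 2 (Eq (Mul (Var 1) (Var 1)) (Mul (Var 0) (Var 2)))))))
    (Neg (exists_commuting 1 (Neg (exists_commuting 2 (exists_commuting 3
      (Conj (Eq (Var 1) (Add (Var 2) (Mul (Var 0) (Var 3))))
        (Neg (Conj (Neg (Eq (Var 2) Zero))
          (Neg (exists_commuting 4 (Eq (Mul (Var 2) (Var 4)) (Mul (Var 0) (Var 0))))))))))))))"

lemma free_vars_exists_commuting: "free_vars (exists_commuting i \<phi>) = ({0} \<union> free_vars \<phi>) - {i}"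
  by (auto simp: exists_commuting_def)

lemma sat_exists_commuting:
  "i \<noteq> 0 \<Longrightarrow> sat (free_assoc_algebra0 X) E (exists_commuting i \<phi>) \<longleftrightarrow>
    (\<exists>a\<in>centralizer0 X (E 0). sat (free_assoc_algebra0 X) (E(i := a)) \<phi>)"
  by (auto simp: exists_commuting_def centralizer0_def)

lemma sat_polynomial_like_formula:
  "sat (free_assoc_algebra0 X) E polynomial_like_formula \<longleftrightarrow> polynomial_like X (E 0)"
  by (simp add: polynomial_like_formula_def polynomial_like_def sat_exists_commuting)

theorem theorem9p2:
  fixes X :: "'x set"
  assumes "finite X" and "X \<noteq> {}"
  shows "\<not> decidable_theory
    (elementary_theory (free_assoc_algebra0 X :: ('x word \<Rightarrow>\<^sub>0 'k::field) set))"
proof -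
  let ?A = "free_assoc_algebra0 X :: ('x word \<Rightarrow>\<^sub>0 'k::field) set"
  let ?U = "{u \<in> ?A. polynomial_like X u}"
  interpret polynomial_interpretation ?A ?U polynomial_like_formula "\<lambda>u p. u * eval_at u p"
  proof
    show "?U \<subseteq> ?A" by blast
    show "?U \<noteq> {}"
    proof -
      obtain x where "x \<in> X" using assms(2) by blast
      from polynomial_like_letter[OF this, where ?'k = 'k] show ?thesis by blast
    qed
    show "0 \<in> ?A" by (rule zero_in_free_assoc_algebra0)
    show "free_vars polynomial_like_formula \<subseteq> {0}"
      by (auto simp: polynomial_like_formula_def free_vars_exists_commuting)
    show "sat ?A E polynomial_like_formula \<longleftrightarrow> E 0 \<in> ?U" if "E 0 \<in> ?A" for E
      using that by (simp add: sat_polynomial_like_formula)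
    fix u assume "u \<in> ?U"
    then have u: "u \<in> ?A" "polynomial_like X u" "u \<noteq> 0" by (auto simp: polynomial_like_def)
    \<comment> \<open>The range is the description of the centralizer; injectivity is cancellation
      of u and its transcendence.\<close>
    show "bij_betw (\<lambda>p. u * eval_at u p) UNIV {a \<in> ?A. a * u = u * a}"
      unfolding bij_betw_def centralizer0_def[symmetric] centralizer0_polynomial_like[OF u(1,2)]
      using word_poly_mult_left_cancel[OF u(3)] eval_at_eq_iff[OF u(1,3)] by (auto intro!: injI)
    fix p q
    show "u * eval_at u (p + q) = u * eval_at u p + u * eval_at u q"
      by (simp add: eval_at_add distrib_left)
    show "u * eval_at u p * (u * eval_at u q) = u * (u * eval_at u (p * q))"
      by (rule mult_eval_at_mult)
    show "u * eval_at u 1 = u" by simp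
    show "u * eval_at u (pCons 0 p) = u * (u * eval_at u p)" by simp
  qed
  show ?thesis by (rule undecidable)
qed

end
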